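(* Let $\Omega\subset\mathbb{R}^n$ be open and bounded, let $m=m_1+m_2$ with $1\le m_1\le m$, and let $F_1,\dots,F_m:\Omega\times\mathbb{R}^{m_1}\times\mathbb{R}^{m_2}\times\mathbb{R}^n\times\mathbf{S}^n\to\mathbb{R}$ be continuous, degenerate elliptic and balanced quasi-monotone. Consider the system $$F_i(x,\mathbf{u}(x),Du_i(x),D^2u_i(x))=0\quad\text{in }\Omega,\qquad i=1,\dots,m.$$ Suppose there exist a bounded super-sub solution $\mathbf{z}=(\mathbf{z}_1,\mathbf{z}_2)$ and a bounded sub-super solution $\mathbf{w}=(\mathbf{w}_1,\mathbf{w}_2)$ of this system such that (componentwise) $$\mathbf{z}_1\ge\mathbf{w}_1\ \text{ in }\Omega,\qquad \mathbf{z}_2\le\mathbf{w}_2\ \text{ in }\Omega.$$ Then there exists a solution $\mathbf{u}=(\mathbf{u}_1,\mathbf{u}_2)$ of the system such that $$\mathbf{z}_1\ge\mathbf{u}_1\ge\mathbf{w}_1\ \text{ in }\Omega,\qquad \mathbf{z}_2\le\mathbf{u}_2\le\mathbf{w}_2\ \text{ in }\Omega.$$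
   Context: $\mathbf{S}^n$ is the space of real symmetric $n\times n$ matrices with the usual partial order. Inequalities between vectors are componentwise. A vector in $\mathbb{R}^m$ is written $(r,s)$ with $r\in\mathbb{R}^{m_1}$, $s\in\mathbb{R}^{m_2}$, and a function $\mathbf{u}:\Omega\to\mathbb{R}^m$ is written $\mathbf{u}=(\mathbf{u}_1,\mathbf{u}_2)=(u_{11},\dots,u_{1m_1},u_{21},\dots,u_{2m_2})$; if $m_2=0$, everything concerning the second group is void. Degenerate ellipticity: for each $i\in\{1,\dots,m\}$ and all $(x,r,s,p)$, $F_i(x,r,s,p,X)\ge F_i(x,r,s,p,Y)$ whenever $X\le Y$ in $\mathbf{S}^n$. Balanced quasi-monotonicity: for all $(x,p,X)\in\Omega\times\mathbb{R}^n\times\mathbf{S}^n$, for $1\le j\le m_1$: $F_j(x,r,s,p,X)\le F_j(x,r,\sigma,p,X)$ whenever $s\le\sigma$, and $F_j(x,r,s,p,X)\ge F_j(x,\rho,s,p,X)$ whenever $r\le\rho$ and $r_j=\rho_j$; for $1\le j\le m_2$: $F_{m_1+j}(x,r,s,p,X)\le F_{m_1+j}(x,\rho,s,p,X)$ whenever $r\le\rho$, and $F_{m_1+j}(x,r,s,p,X)\ge F_{m_1+j}(x,r,\sigma,p,X)$ whenever $s\le\sigma$ and $s_j=\sigma_j$. Envelopes: for $f:\Omega\to\mathbb{R}$, $f^*(x)=\limsup_{y\to x}f(y)$ and $f_*(x)=\liminf_{y\to x}f(y)$ (with $y=x$ allowed) are the upper and lower semicontinuous envelopes; for vector-valued functions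 they are taken componentwise. Touching: $\varphi$ touches $f$ from above (below) at $x\in\Omega$ if $\varphi(x)=f(x)$ and $\varphi>f$ ($\varphi<f$) in $\mathcal{N}\setminus\{x\}$ for some open neighborhood $\mathcal{N}$ of $x$. Super-sub solution: a bounded function $(\mathbf{u}_1,\mathbf{u}_2):\Omega\to\mathbb{R}^{m_1}\times\mathbb{R}^{m_2}$ such that for each $x\in\Omega$: for all $1\le j\le m_1$, $F_j(x,\mathbf{u}_{1*}(x),\mathbf{u}_2^*(x),D\varphi(x),D^2\varphi(x))\ge0$ whenever $\varphi\in C^2(\Omega)$ touches $u_{1j*}$ from below at $x$; and for all $1\le j\le m_2$, $F_{m_1+j}(x,\mathbf{u}_{1*}(x),\mathbf{u}_2^*(x),D\varphi(x),D^2\varphi(x))\le0$ whenever $\varphi\in C^2(\Omega)$ touches $u_{2j}^*$ from above at $x$. Sub-super solution: a bounded function $(\mathbf{u}_1,\mathbf{u}_2):\Omega\to\mathbb{R}^{m_1}\times\mathbb{R}^{m_2}$ such that for each $x\in\Omega$: for all $1\le j\le m_1$, $F_j(x,\mathbf{u}_1^*(x),\mathbf{u}_{2*}(x),D\varphi(x),D^2\varphi(x))\le0$ whenever $\varphi\in C^2(\Omega)$ touches $u_{1j}^*$ from above at $x$; and for all $1\le j\le m_2$, $F_{m_1+j}(x,\mathbf{u}_1^*(x),\mathbf{u}_{2*}(x),D\varphi(x),D^2\varphi(x))\ge0$ whenever $\varphi\in C^2(\Omega)$ touches $u_{2j*}$ from below at $x$. Solution: a bounded function that is both a super-sub solution and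 a sub-super solution (no continuity is required). *)

theory Defs
  imports "HOL-Analysis.Analysis"
begin

text \<open>
  Vectors of \<open>\<real>\<^sup>k\<close>, for a number \<open>k\<close> that may be 0, are the extensional functions on
  \<open>{..<k}\<close>; components are numbered from 0. On this set the product topology of the type
  \<^typ>\<open>nat \<Rightarrow> real\<close> is the Euclidean one, but its metric is bounded, so the library's
  \<open>bounded\<close> must not be applied to vectors, only to their components.
\<close>

definition Rvec :: "nat \<Rightarrow> (nat \<Rightarrow> real) set" where
  "Rvec k = ({..<k} \<rightarrow>\<^sub>E UNIV)"

definition vec_le :: "nat \<Rightarrow> (nat \<Rightarrow> real) \<Rightarrow> (nat \<Rightarrow> real) \<Rightarrow> bool" where
  "vec_le k r \<rho> \<longleftrightarrow> (\<forall>j<k. r j \<le> \<rho> j)"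

definition sym_matrices :: "(real^'n^'n) set" where
  "sym_matrices = {X. transpose X = X}"

definition matrix_le :: "real^'n^'n \<Rightarrow> real^'n^'n \<Rightarrow> bool" where
  "matrix_le X Y \<longleftrightarrow> (\<forall>v. v \<bullet> (X *v v) \<le> v \<bullet> (Y *v v))"

text \<open>
  The nonlinearity \<open>F\<^sub>i(x,r,s,p,X)\<close> is \<open>F i x r s p X\<close>. The first group consists of the
  indices \<open>j < m1\<close>, the second one of the indices \<open>m1 + j\<close> with \<open>j < m2\<close>.
\<close>

type_synonym 'n nonlinearity =
  "nat \<Rightarrow> real^'n \<Rightarrow> (nat \<Rightarrow> real) \<Rightarrow> (nat \<Rightarrow> real) \<Rightarrow> real^'n \<Rightarrow> real^'n^'n \<Rightarrow> real"

definition continuous_system ::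
  "(real^'n) set \<Rightarrow> nat \<Rightarrow> nat \<Rightarrow> 'n nonlinearity \<Rightarrow> bool" where
  "continuous_system \<Omega> m1 m2 F \<longleftrightarrow>
     (\<forall>i<m1+m2. continuous_on (\<Omega> \<times> Rvec m1 \<times> Rvec m2 \<times> UNIV \<times> sym_matrices)
        (\<lambda>(x, r, s, p, X). F i x r s p X))"

definition degenerate_elliptic ::
  "(real^'n) set \<Rightarrow> nat \<Rightarrow> nat \<Rightarrow> 'n nonlinearity \<Rightarrow> bool" where
  "degenerate_elliptic \<Omega> m1 m2 F \<longleftrightarrow>
     (\<forall>i<m1+m2. \<forall>x\<in>\<Omega>. \<forall>r\<in>Rvec m1. \<forall>s\<in>Rvec m2. \<forall>p. \<forall>X\<in>sym_matrices. \<forall>Y\<in>sym_matrices.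
        matrix_le X Y \<longrightarrow> F i x r s p X \<ge> F i x r s p Y)"

definition balanced_quasi_monotone ::
  "(real^'n) set \<Rightarrow> nat \<Rightarrow> nat \<Rightarrow> 'n nonlinearity \<Rightarrow> bool" where
  "balanced_quasi_monotone \<Omega> m1 m2 F \<longleftrightarrow>
     (\<forall>x\<in>\<Omega>. \<forall>p. \<forall>X\<in>sym_matrices.
        (\<forall>j<m1.
           (\<forall>r\<in>Rvec m1. \<forall>s\<in>Rvec m2. \<forall>\<sigma>\<in>Rvec m2.
              vec_le m2 s \<sigma> \<longrightarrow> F j x r s p X \<le> F j x r \<sigma> p X) \<and>
           (\<forall>r\<in>Rvec m1. \<forall>\<rho>\<in>Rvec m1. \<forall>s\<in>Rvec m2.
              vec_le m1 r \<rho> \<and> r j = \<rho> j \<longrightarrow> F j x r s p X \<ge> F j x \<rho> s p X)) \<and>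
        (\<forall>j<m2.
           (\<forall>r\<in>Rvec m1. \<forall>\<rho>\<in>Rvec m1. \<forall>s\<in>Rvec m2.
              vec_le m1 r \<rho> \<longrightarrow> F (m1 + j) x r s p X \<le> F (m1 + j) x \<rho> s p X) \<and>
           (\<forall>r\<in>Rvec m1. \<forall>s\<in>Rvec m2. \<forall>\<sigma>\<in>Rvec m2.
              vec_le m2 s \<sigma> \<and> s j = \<sigma> j \<longrightarrow>
                F (m1 + j) x r s p X \<ge> F (m1 + j) x r \<sigma> p X)))"

text \<open>
  The filter \<open>inf (nhds x) (principal \<Omega>)\<close> describes \<open>y \<rightarrow> x\<close> in \<open>\<Omega>\<close> with \<open>y = x\<close> allowed,
  unlike \<open>at x within \<Omega>\<close>. The envelopes are used for bounded functions only, whose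
  limits superior and inferior in the extended reals are finite at points of \<open>\<Omega>\<close>.
\<close>

definition usc_env :: "(real^'n) set \<Rightarrow> (real^'n \<Rightarrow> real) \<Rightarrow> real^'n \<Rightarrow> real" where
  "usc_env \<Omega> f x =
     real_of_ereal (Limsup (inf (nhds x) (principal \<Omega>)) (\<lambda>y. ereal (f y)))"

definition lsc_env :: "(real^'n) set \<Rightarrow> (real^'n \<Rightarrow> real) \<Rightarrow> real^'n \<Rightarrow> real" where
  "lsc_env \<Omega> f x =
     real_of_ereal (Liminf (inf (nhds x) (principal \<Omega>)) (\<lambda>y. ereal (f y)))"

definition usc_env_vec ::
  "nat \<Rightarrow> (real^'n) set \<Rightarrow> (real^'n \<Rightarrow> nat \<Rightarrow> real) \<Rightarrow> real^'n \<Rightarrow> nat \<Rightarrow> real" where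
  "usc_env_vec k \<Omega> u x = (\<lambda>j\<in>{..<k}. usc_env \<Omega> (\<lambda>y. u y j) x)"

definition lsc_env_vec ::
  "nat \<Rightarrow> (real^'n) set \<Rightarrow> (real^'n \<Rightarrow> nat \<Rightarrow> real) \<Rightarrow> real^'n \<Rightarrow> nat \<Rightarrow> real" where
  "lsc_env_vec k \<Omega> u x = (\<lambda>j\<in>{..<k}. lsc_env \<Omega> (\<lambda>y. u y j) x)"

definition touches_above ::
  "(real^'n) set \<Rightarrow> (real^'n \<Rightarrow> real) \<Rightarrow> (real^'n \<Rightarrow> real) \<Rightarrow> real^'n \<Rightarrow> bool" where
  "touches_above \<Omega> \<phi> f x \<longleftrightarrow>
     \<phi> x = f x \<and> (\<exists>N. open N \<and> x \<in> N \<and> (\<forall>y\<in>N \<inter> \<Omega> - {x}. \<phi> y > f y))"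

definition touches_below ::
  "(real^'n) set \<Rightarrow> (real^'n \<Rightarrow> real) \<Rightarrow> (real^'n \<Rightarrow> real) \<Rightarrow> real^'n \<Rightarrow> bool" where
  "touches_below \<Omega> \<phi> f x \<longleftrightarrow>
     \<phi> x = f x \<and> (\<exists>N. open N \<and> x \<in> N \<and> (\<forall>y\<in>N \<inter> \<Omega> - {x}. \<phi> y < f y))"

text \<open>
  \<open>\<phi> \<in> C\<^sup>2(\<Omega>)\<close> with gradient \<open>D\<phi>\<close> and Hessian matrix \<open>D2\<phi>\<close> on the open set \<open>\<Omega>\<close>, where both
  are uniquely determined by \<open>\<phi>\<close>. The Hessian is symmetric by Schwarz's theorem.
\<close>

definition C2_with_derivs ::
  "(real^'n) set \<Rightarrow> (real^'n \<Rightarrow> real) \<Rightarrow> (real^'n \<Rightarrow> real^'n) \<Rightarrow> (real^'n \<Rightarrow> real^'n^'n) \<Rightarrow> bool" where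
  "C2_with_derivs \<Omega> \<phi> D\<phi> D2\<phi> \<longleftrightarrow>
     (\<forall>x\<in>\<Omega>. GDERIV \<phi> x :> D\<phi> x) \<and>
     (\<forall>x\<in>\<Omega>. (D\<phi> has_derivative (\<lambda>h. D2\<phi> x *v h)) (at x)) \<and>
     continuous_on \<Omega> D2\<phi>"

definition bounded_vector_fun ::
  "(real^'n) set \<Rightarrow> nat \<Rightarrow> (real^'n \<Rightarrow> nat \<Rightarrow> real) \<Rightarrow> bool" where
  "bounded_vector_fun \<Omega> k u \<longleftrightarrow>
     u \<in> \<Omega> \<rightarrow> Rvec k \<and> (\<forall>j<k. bounded ((\<lambda>x. u x j) ` \<Omega>))"

definition super_sub_solution ::
  "(real^'n) set \<Rightarrow> nat \<Rightarrow> nat \<Rightarrow> 'n nonlinearity \<Rightarrow>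
     (real^'n \<Rightarrow> nat \<Rightarrow> real) \<Rightarrow> (real^'n \<Rightarrow> nat \<Rightarrow> real) \<Rightarrow> bool" where
  "super_sub_solution \<Omega> m1 m2 F u1 u2 \<longleftrightarrow>
     bounded_vector_fun \<Omega> m1 u1 \<and> bounded_vector_fun \<Omega> m2 u2 \<and>
     (\<forall>x\<in>\<Omega>.
        (\<forall>j<m1. \<forall>\<phi> D\<phi> D2\<phi>.
           C2_with_derivs \<Omega> \<phi> D\<phi> D2\<phi> \<and> touches_below \<Omega> \<phi> (lsc_env \<Omega> (\<lambda>y. u1 y j)) x \<longrightarrow>
           F j x (lsc_env_vec m1 \<Omega> u1 x) (usc_env_vec m2 \<Omega> u2 x) (D\<phi> x) (D2\<phi> x) \<ge> 0) \<and>
        (\<forall>j<m2. \<forall>\<phi> D\<phi> D2\<phi>.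
           C2_with_derivs \<Omega> \<phi> D\<phi> D2\<phi> \<and> touches_above \<Omega> \<phi> (usc_env \<Omega> (\<lambda>y. u2 y j)) x \<longrightarrow>
           F (m1 + j) x (lsc_env_vec m1 \<Omega> u1 x) (usc_env_vec m2 \<Omega> u2 x) (D\<phi> x) (D2\<phi> x) \<le> 0))"

definition sub_super_solution ::
  "(real^'n) set \<Rightarrow> nat \<Rightarrow> nat \<Rightarrow> 'n nonlinearity \<Rightarrow>
     (real^'n \<Rightarrow> nat \<Rightarrow> real) \<Rightarrow> (real^'n \<Rightarrow> nat \<Rightarrow> real) \<Rightarrow> bool" where
  "sub_super_solution \<Omega> m1 m2 F u1 u2 \<longleftrightarrow>
     bounded_vector_fun \<Omega> m1 u1 \<and> bounded_vector_fun \<Omega> m2 u2 \<and>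
     (\<forall>x\<in>\<Omega>.
        (\<forall>j<m1. \<forall>\<phi> D\<phi> D2\<phi>.
           C2_with_derivs \<Omega> \<phi> D\<phi> D2\<phi> \<and> touches_above \<Omega> \<phi> (usc_env \<Omega> (\<lambda>y. u1 y j)) x \<longrightarrow>
           F j x (usc_env_vec m1 \<Omega> u1 x) (lsc_env_vec m2 \<Omega> u2 x) (D\<phi> x) (D2\<phi> x) \<le> 0) \<and>
        (\<forall>j<m2. \<forall>\<phi> D\<phi> D2\<phi>.
           C2_with_derivs \<Omega> \<phi> D\<phi> D2\<phi> \<and> touches_below \<Omega> \<phi> (lsc_env \<Omega> (\<lambda>y. u2 y j)) x \<longrightarrow>
           F (m1 + j) x (usc_env_vec m1 \<Omega> u1 x) (lsc_env_vec m2 \<Omega> u2 x) (D\<phi> x) (D2\<phi> x) \<ge> 0))"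

definition system_solution ::
  "(real^'n) set \<Rightarrow> nat \<Rightarrow> nat \<Rightarrow> 'n nonlinearity \<Rightarrow>
     (real^'n \<Rightarrow> nat \<Rightarrow> real) \<Rightarrow> (real^'n \<Rightarrow> nat \<Rightarrow> real) \<Rightarrow> bool" where
  "system_solution \<Omega> m1 m2 F u1 u2 \<longleftrightarrow>
     super_sub_solution \<Omega> m1 m2 F u1 u2 \<and> sub_super_solution \<Omega> m1 m2 F u1 u2"

end

theory Submission
  imports Defs
begin

text \<open>
  In terms of \<open>U = (u\<^sub>1, - u\<^sub>2)\<close> the balanced system becomes an ordinary quasi-monotone one, each
  equation being nonincreasing in the other unknowns, and Perron's method applies: the solution is
  the componentwise supremum \<open>u\<close> of all subsolutions between \<open>w\<close> and \<open>z\<close>. A test function touching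
  \<open>u\<^sup>*\<close> from above is nearly touched by the members of the family, which makes \<open>u\<close> a subsolution. If
  some \<open>\<phi>\<close> touching the \<open>i\<close>-th component of \<open>u\<^sub>*\<close> from below violated the supersolution inequality,
  that component would lie strictly below \<open>z\<^sub>*\<close> there by quasi-monotonicity, and raising it to
  \<open>max u\<^sub>i (\<phi> + \<delta>)\<close> near the point would give a larger subsolution in the family.

  Subtracting a quartic centred at the contact point leaves the second-order jet there unchanged and
  gives a quantified gap away from it, so no minimisation over spheres is needed.
\<close>

section \<open>Twice continuously differentiable functions\<close>

text \<open>Contact with a test function controls only the component being tested. When a member
  \<open>v\<close> of the family nearly attains the supremum in component \<open>i\<close>, nothing
  brings its other components near those of \<open>u\<close>; all that is known is that their upper
  envelopes lie below those of \<open>u\<close>. So one cannot simply pass to the limit in the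
  inequality for \<open>v\<close>. Quasi-monotonicity closes the gap: raising the other components
  to values near those at the contact point only lowers the \<open>i\<close>-th equation, so the
  inequality \<le> 0 is kept while the arguments enter the range where continuity applies. In the
  second half the comparison vector is obtained by lowering instead: continuity gives a negative
  value there, and going back up lowers it further.

  The same one-sidedness is why a single component can be raised: the equations of the components
  left alone can only decrease. As the envelopes of \<open>u\<close> may differ, each half of the
  argument evaluates the equations at its own envelope, and the sign change in the second group has
  to exchange the two.\<close>

lemma C2_line_deriv1:
  assumes "C2_with_derivs \<Omega> \<phi> D\<phi> D2\<phi>" "x + t *\<^sub>R v \<in> \<Omega>"
  shows "((\<lambda>t. \<phi> (x + t *\<^sub>R v)) has_real_derivative v \<bullet> D\<phi> (x + t *\<^sub>R v)) (at t within S)"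
proof -
  have "GDERIV \<phi> (x + t *\<^sub>R v) :> D\<phi> (x + t *\<^sub>R v)"
    using assms by (auto simp: C2_with_derivs_def)
  then have 1: "(\<phi> has_derivative (\<lambda>h. h \<bullet> D\<phi> (x + t *\<^sub>R v))) (at (x + t *\<^sub>R v))"
    by (simp add: gderiv_def)
  have 2: "((\<lambda>t. x + t *\<^sub>R v) has_derivative (\<lambda>h. h *\<^sub>R v)) (at t within S)"
    by (auto intro!: derivative_eq_intros)
  show ?thesis
    using has_derivative_compose[OF 2 1] by (simp add: has_field_derivative_def mult_commute_abs)
qed

lemma C2_line_deriv2:
  assumes "C2_with_derivs \<Omega> \<phi> D\<phi> D2\<phi>" "x + t *\<^sub>R v \<in> \<Omega>"
  shows "((\<lambda>t. u \<bullet> D\<phi> (x + t *\<^sub>R v)) has_real_derivative u \<bullet> (D2\<phi> (x + t *\<^sub>R v) *v v)) (at t within S)"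
proof -
  have 1: "(D\<phi> has_derivative (\<lambda>h. D2\<phi> (x + t *\<^sub>R v) *v h)) (at (x + t *\<^sub>R v))"
    using assms by (auto simp: C2_with_derivs_def)
  have 2: "((\<lambda>t. x + t *\<^sub>R v) has_derivative (\<lambda>h. h *\<^sub>R v)) (at t within S)"
    by (auto intro!: derivative_eq_intros)
  have "((\<lambda>t. D\<phi> (x + t *\<^sub>R v)) has_derivative (\<lambda>h. D2\<phi> (x + t *\<^sub>R v) *v (h *\<^sub>R v))) (at t within S)"
    by (rule has_derivative_compose[OF 2 1])
  from has_derivative_inner_right[OF this, of u]
  show ?thesis by (simp add: has_field_derivative_def matrix_vector_mult_scaleR mult_commute_abs)
qed

lemma C2_continuous_on:
  assumes "C2_with_derivs \<Omega> \<phi> D\<phi> D2\<phi>"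
  shows "continuous_on \<Omega> \<phi>" "continuous_on \<Omega> D\<phi>" "continuous_on \<Omega> D2\<phi>"
proof -
  show "continuous_on \<Omega> \<phi>"
    using assms unfolding C2_with_derivs_def gderiv_def
    by (meson continuous_at_imp_continuous_on has_derivative_continuous)
  show "continuous_on \<Omega> D\<phi>"
    using assms unfolding C2_with_derivs_def
    by (meson continuous_at_imp_continuous_on has_derivative_continuous)
qed (use assms in \<open>auto simp: C2_with_derivs_def\<close>)

text \<open>Both mixed second derivatives are values, near \<open>x\<close>, of the same second difference.\<close>

lemma C2_second_difference:
  assumes C2: "C2_with_derivs \<Omega> \<phi> D\<phi> D2\<phi>" and "t > 0"
    and sub: "\<And>a b. \<bar>a\<bar> \<le> t \<Longrightarrow> \<bar>b\<bar> \<le> t \<Longrightarrow> x + a *\<^sub>R u + b *\<^sub>R v \<in> \<Omega>"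
  shows "\<exists>a b. 0 < a \<and> a < t \<and> 0 < b \<and> b < t \<and>
    \<phi> (x + t *\<^sub>R u + t *\<^sub>R v) - \<phi> (x + t *\<^sub>R u) - \<phi> (x + t *\<^sub>R v) + \<phi> x
      = t\<^sup>2 * (u \<bullet> (D2\<phi> (x + a *\<^sub>R u + b *\<^sub>R v) *v v))"
proof -
  define g where "g s = \<phi> (x + t *\<^sub>R v + s *\<^sub>R u) - \<phi> (x + s *\<^sub>R u)" for s
  have "(g has_real_derivative u \<bullet> D\<phi> (x + t *\<^sub>R v + s *\<^sub>R u) - u \<bullet> D\<phi> (x + s *\<^sub>R u)) (at s)"
    if "0 \<le> s" "s \<le> t" for s
    unfolding g_def
    using sub[of s t] sub[of s 0] that
    by (intro DERIV_diff C2_line_deriv1[OF C2]) (auto simp: algebra_simps)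
  from MVT2[OF \<open>t > 0\<close> this] obtain a where a: "0 < a" "a < t"
    "g t - g 0 = (t - 0) * (u \<bullet> D\<phi> (x + t *\<^sub>R v + a *\<^sub>R u) - u \<bullet> D\<phi> (x + a *\<^sub>R u))"
    by blast
  have "((\<lambda>s. u \<bullet> D\<phi> ((x + a *\<^sub>R u) + s *\<^sub>R v)) has_real_derivative
      u \<bullet> (D2\<phi> ((x + a *\<^sub>R u) + s *\<^sub>R v) *v v)) (at s)" if "0 \<le> s" "s \<le> t" for s
    using sub[of a s] that a by (intro C2_line_deriv2[OF C2]) auto
  from MVT2[OF \<open>t > 0\<close> this] obtain b where b: "0 < b" "b < t"
    "u \<bullet> D\<phi> (x + a *\<^sub>R u + t *\<^sub>R v) - u \<bullet> D\<phi> (x + a *\<^sub>R u + 0 *\<^sub>R v)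
      = (t - 0) * (u \<bullet> (D2\<phi> (x + a *\<^sub>R u + b *\<^sub>R v) *v v))"
    by blast
  have "g t - g 0 = t\<^sup>2 * (u \<bullet> (D2\<phi> (x + a *\<^sub>R u + b *\<^sub>R v) *v v))"
    using a(3) b(3) by (simp add: power2_eq_square add_ac)
  moreover have "g t - g 0 = \<phi> (x + t *\<^sub>R u + t *\<^sub>R v) - \<phi> (x + t *\<^sub>R u) - \<phi> (x + t *\<^sub>R v) + \<phi> x"
    by (simp add: g_def add_ac)
  ultimately show ?thesis using a(1,2) b(1,2) by metis
qed

text \<open>Continuity, ellipticity and monotonicity of the nonlinearity are available on symmetric
  matrices only, so every later use of a Hessian passes through this fact. Both mixed values are
  limits of one second difference quotient, which is symmetric in \<open>u\<close> and
  \<open>v\<close>.\<close>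

lemma C2_hessian_symmetric:
  assumes C2: "C2_with_derivs \<Omega> \<phi> D\<phi> D2\<phi>" and "open \<Omega>" "x \<in> \<Omega>"
  shows "D2\<phi> x \<in> sym_matrices"
proof -
  have sym: "u \<bullet> (D2\<phi> x *v v) = v \<bullet> (D2\<phi> x *v u)" for u v
  proof (rule ccontr)
    assume neq: "\<not> ?thesis"
    \<comment> \<open>Half the gap: a common value within \<open>e\<close> of both numbers would put
      them at distance less than \<open>2 * e\<close>, which is the gap itself.\<close>
    define e where "e = \<bar>u \<bullet> (D2\<phi> x *v v) - v \<bullet> (D2\<phi> x *v u)\<bar> / 2"
    have "e > 0" using neq by (simp add: e_def)
    have cont: "continuous_on \<Omega> (\<lambda>y. p \<bullet> (D2\<phi> y *v q))" for p q
      unfolding matrix_vector_mult_def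
      using C2_continuous_on(3)[OF C2] by (intro continuous_intros)
    have "\<forall>\<^sub>F y in at x. dist (p \<bullet> (D2\<phi> y *v q)) (p \<bullet> (D2\<phi> x *v q)) < e" for p q
    proof -
      have "isCont (\<lambda>y. p \<bullet> (D2\<phi> y *v q)) x"
        using cont[of p q] assms continuous_on_eq_continuous_at by blast
      then show ?thesis using \<open>e > 0\<close> by (simp add: isCont_def tendstoD)
    qed
    then have "\<forall>\<^sub>F y in at x. dist (u \<bullet> (D2\<phi> y *v v)) (u \<bullet> (D2\<phi> x *v v)) < e \<and>
        dist (v \<bullet> (D2\<phi> y *v u)) (v \<bullet> (D2\<phi> x *v u)) < e \<and> y \<in> \<Omega>"
      using assms(2,3) by (simp add: eventually_conj eventually_at_in_open')
    then obtain d where "d > 0" and d: "\<And>y. dist y x < d \<Longrightarrow> y \<in> \<Omega> \<and>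
        dist (u \<bullet> (D2\<phi> y *v v)) (u \<bullet> (D2\<phi> x *v v)) < e \<and>
        dist (v \<bullet> (D2\<phi> y *v u)) (v \<bullet> (D2\<phi> x *v u)) < e"
      unfolding eventually_at using \<open>x \<in> \<Omega>\<close> \<open>e > 0\<close> by (metis UNIV_I dist_self)
    \<comment> \<open>The summand 1 keeps \<open>K\<close> positive when both directions vanish; the
      scale \<open>t\<close> then keeps the whole parallelogram inside the ball of radius
      \<open>d\<close>.\<close>
    define K where "K = norm u + norm v + 1"
    define t where "t = d / 2 / K"
    have pos: "K > 0" by (simp add: K_def add_nonneg_pos)
    have "t > 0" using \<open>d > 0\<close> pos by (simp add: t_def)
    have tn: "t * (norm u + norm v) < d"
    proof -
      have "t * (norm u + norm v) \<le> t * K"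
        using \<open>t > 0\<close> by (simp add: K_def)
      also have "\<dots> = d / 2" using pos unfolding t_def by simp
      finally show ?thesis using \<open>d > 0\<close> by simp
    qed
    have near: "dist (x + a *\<^sub>R u + b *\<^sub>R v) x < d" if "\<bar>a\<bar> \<le> t" "\<bar>b\<bar> \<le> t" for a b
    proof -
      have "dist (x + a *\<^sub>R u + b *\<^sub>R v) x \<le> \<bar>a\<bar> * norm u + \<bar>b\<bar> * norm v"
        by (simp add: dist_norm add.assoc norm_triangle_le)
      also have "\<dots> \<le> t * norm u + t * norm v"
        using that by (intro add_mono mult_right_mono) auto
      finally show ?thesis using tn by (simp add: algebra_simps)
    qed
    obtain a b where ab: "0 < a" "a < t" "0 < b" "b < t" and 1:
      "\<phi> (x + t *\<^sub>R u + t *\<^sub>R v) - \<phi> (x + t *\<^sub>R u) - \<phi> (x + t *\<^sub>R v) + \<phi> x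
        = t\<^sup>2 * (u \<bullet> (D2\<phi> (x + a *\<^sub>R u + b *\<^sub>R v) *v v))"
      using C2_second_difference[OF C2 \<open>t > 0\<close>, of x u v] near d by blast
    have near': "dist (x + a *\<^sub>R v + b *\<^sub>R u) x < d" if "\<bar>a\<bar> \<le> t" "\<bar>b\<bar> \<le> t" for a b
      using near[OF that(2,1)] by (simp add: add_ac)
    obtain a' b' where ab': "0 < a'" "a' < t" "0 < b'" "b' < t" and 2:
      "\<phi> (x + t *\<^sub>R v + t *\<^sub>R u) - \<phi> (x + t *\<^sub>R v) - \<phi> (x + t *\<^sub>R u) + \<phi> x
        = t\<^sup>2 * (v \<bullet> (D2\<phi> (x + a' *\<^sub>R v + b' *\<^sub>R u) *v u))"
      using C2_second_difference[OF C2 \<open>t > 0\<close>, of x v u] near' d by blast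
    have "u \<bullet> (D2\<phi> (x + a *\<^sub>R u + b *\<^sub>R v) *v v) = v \<bullet> (D2\<phi> (x + a' *\<^sub>R v + b' *\<^sub>R u) *v u)"
    proof -
      have "x + t *\<^sub>R u + t *\<^sub>R v = x + t *\<^sub>R v + t *\<^sub>R u" by (simp add: add_ac)
      then have "t\<^sup>2 * (u \<bullet> (D2\<phi> (x + a *\<^sub>R u + b *\<^sub>R v) *v v))
          = t\<^sup>2 * (v \<bullet> (D2\<phi> (x + a' *\<^sub>R v + b' *\<^sub>R u) *v u))"
        using 1 2 by (smt (verit))
      then show ?thesis using \<open>t > 0\<close> by simp
    qed
    moreover have "dist (u \<bullet> (D2\<phi> (x + a *\<^sub>R u + b *\<^sub>R v) *v v)) (u \<bullet> (D2\<phi> x *v v)) < e"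
      using ab near d by simp
    moreover have "dist (v \<bullet> (D2\<phi> (x + a' *\<^sub>R v + b' *\<^sub>R u) *v u)) (v \<bullet> (D2\<phi> x *v u)) < e"
      using ab' near' d by simp
    ultimately have "dist (u \<bullet> (D2\<phi> x *v v)) (v \<bullet> (D2\<phi> x *v u)) < 2 * e"
      using dist_triangle_half_r[of _ _ "2 * e"] by simp
    then show False by (simp add: dist_real_def e_def)
  qed
  have "D2\<phi> x $ i $ j = D2\<phi> x $ j $ i" for i j
    using sym[of "axis i 1" "axis j 1"]
    by (simp add: inner_axis' matrix_vector_mult_basis column_def)
  then show ?thesis by (simp add: sym_matrices_def transpose_def vec_eq_iff)
qed

section \<open>Operations on test functions and the quartic perturbation\<close>

lemma C2_add:
  assumes "C2_with_derivs \<Omega> \<phi> D\<phi> D2\<phi>" "C2_with_derivs \<Omega> \<psi> D\<psi> D2\<psi>"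
  shows "C2_with_derivs \<Omega> (\<lambda>x. \<phi> x + \<psi> x) (\<lambda>x. D\<phi> x + D\<psi> x) (\<lambda>x. D2\<phi> x + D2\<psi> x)"
proof -
  have "((\<lambda>x. D\<phi> x + D\<psi> x) has_derivative (\<lambda>h. (D2\<phi> x + D2\<psi> x) *v h)) (at x)" if "x \<in> \<Omega>" for x
    unfolding matrix_vector_mult_add_rdistrib
    using assms that by (intro has_derivative_add) (auto simp: C2_with_derivs_def)
  then show ?thesis
    using assms unfolding C2_with_derivs_def by (auto intro!: GDERIV_add continuous_intros)
qed

lemma uminus_matrix_vector_mult: "(- A) *v v = - (A *v v)" for A :: "real^'n^'m"
  by (simp add: matrix_vector_mult_def vec_eq_iff sum_negf)

lemma C2_minus:
  assumes "C2_with_derivs \<Omega> \<phi> D\<phi> D2\<phi>"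
  shows "C2_with_derivs \<Omega> (\<lambda>x. - \<phi> x) (\<lambda>x. - D\<phi> x) (\<lambda>x. - D2\<phi> x)"
proof -
  have "((\<lambda>x. - D\<phi> x) has_derivative (\<lambda>h. (- D2\<phi> x) *v h)) (at x)" if "x \<in> \<Omega>" for x
    unfolding uminus_matrix_vector_mult
    using assms that by (intro has_derivative_minus) (auto simp: C2_with_derivs_def)
  then show ?thesis
    using assms unfolding C2_with_derivs_def by (auto intro!: GDERIV_minus continuous_intros)
qed

lemma C2_add_const:
  assumes "C2_with_derivs \<Omega> \<phi> D\<phi> D2\<phi>"
  shows "C2_with_derivs \<Omega> (\<lambda>x. \<phi> x + c) D\<phi> D2\<phi>"
  using assms unfolding C2_with_derivs_def gderiv_def
  using has_derivative_add_const by blast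

text \<open>With exponent 4 both the gradient and the Hessian vanish at \<open>a\<close>; the
  rank-one summand of the Hessian comes from differentiating the scalar factor of the gradient.
  Writing the function as a squared inner product keeps it polynomial, so the norm, which is not
  differentiable at 0, never has to be differentiated.\<close>

lemma C2_quartic:
  fixes a :: "real^'n"
  shows "C2_with_derivs \<Omega> (\<lambda>y. ((y - a) \<bullet> (y - a))\<^sup>2)
    (\<lambda>y. (4 * ((y - a) \<bullet> (y - a))) *\<^sub>R (y - a))
    (\<lambda>y. (4 * ((y - a) \<bullet> (y - a))) *\<^sub>R mat 1 + (\<chi> i j. 8 * (y - a) $ i * (y - a) $ j))"
  unfolding C2_with_derivs_def
proof (intro conjI ballI)
  fix x
  show "GDERIV (\<lambda>y. ((y - a) \<bullet> (y - a))\<^sup>2) x :> (4 * ((x - a) \<bullet> (x - a))) *\<^sub>R (x - a)"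
    unfolding gderiv_def
    by (auto intro!: derivative_eq_intros simp: inner_commute algebra_simps fun_eq_iff)
  have *: "((4 * ((x - a) \<bullet> (x - a))) *\<^sub>R mat 1 + (\<chi> i j. 8 * (x - a) $ i * (x - a) $ j)) *v h
      = (4 * ((x - a) \<bullet> (x - a))) *\<^sub>R h + (8 * (h \<bullet> (x - a))) *\<^sub>R (x - a)" for h
  proof -
    have "(\<chi> i j. 8 * (x - a) $ i * (x - a) $ j) *v h = (8 * (h \<bullet> (x - a))) *\<^sub>R (x - a)"
      by (simp add: matrix_vector_mult_def vec_eq_iff inner_vec_def sum_distrib_left sum_distrib_right)
        (intro allI sum.cong refl, algebra)
    then show ?thesis
      by (simp add: matrix_vector_mult_add_rdistrib scaleR_matrix_vector_assoc[symmetric])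
  qed
  show "((\<lambda>y. (4 * ((y - a) \<bullet> (y - a))) *\<^sub>R (y - a)) has_derivative
      (\<lambda>h. ((4 * ((x - a) \<bullet> (x - a))) *\<^sub>R mat 1 + (\<chi> i j. 8 * (x - a) $ i * (x - a) $ j)) *v h)) (at x)"
    unfolding * by (auto intro!: derivative_eq_intros simp: inner_commute algebra_simps fun_eq_iff)
next
  show "continuous_on \<Omega> (\<lambda>y. (4 * ((y - a) \<bullet> (y - a))) *\<^sub>R mat 1 + (\<chi> i j. 8 * (y - a) $ i * (y - a) $ j))"
    by (intro continuous_intros)
qed

lemma C2_perturb_quartic:
  fixes a :: "real^'n"
  assumes "C2_with_derivs \<Omega> \<phi> D\<phi> D2\<phi>"
  obtains D\<psi> D2\<psi> where "C2_with_derivs \<Omega> (\<lambda>y. \<phi> y + ((y - a) \<bullet> (y - a))\<^sup>2) D\<psi> D2\<psi>"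
    "D\<psi> a = D\<phi> a" "D2\<psi> a = D2\<phi> a"
proof
  show "C2_with_derivs \<Omega> (\<lambda>y. \<phi> y + ((y - a) \<bullet> (y - a))\<^sup>2)
    (\<lambda>y. D\<phi> y + (4 * ((y - a) \<bullet> (y - a))) *\<^sub>R (y - a))
    (\<lambda>y. D2\<phi> y + ((4 * ((y - a) \<bullet> (y - a))) *\<^sub>R mat 1 + (\<chi> i j. 8 * (y - a) $ i * (y - a) $ j)))"
    by (intro C2_add assms C2_quartic)
qed (simp_all add: vec_eq_iff)

section \<open>First and second order conditions at a local minimum\<close>

text \<open>The difference \<psi> - \<phi> has a local minimum at \<open>x\<close>, so the
  one-variable conditions along each line through \<open>x\<close> apply. This turns contact of two
  test functions into the matrix inequality on which ellipticity acts.\<close>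

lemma C2_local_min:
  fixes x :: "real^'n"
  assumes C2: "C2_with_derivs \<Omega> \<phi> D\<phi> D2\<phi>" "C2_with_derivs \<Omega> \<psi> D\<psi> D2\<psi>" and "open \<Omega>" "x \<in> \<Omega>"
    and N: "open N" "x \<in> N" "\<And>y. y \<in> N \<inter> \<Omega> \<Longrightarrow> \<phi> y - \<phi> x \<le> \<psi> y - \<psi> x"
  shows "D\<psi> x = D\<phi> x" "matrix_le (D2\<phi> x) (D2\<psi> x)"
proof -
  define h where "h y = \<psi> y + - \<phi> y" for y
  define Dh where "Dh y = D\<psi> y + - D\<phi> y" for y
  define D2h where "D2h y = D2\<psi> y + - D2\<phi> y" for y
  have C: "C2_with_derivs \<Omega> h Dh D2h"
    unfolding h_def[abs_def] Dh_def[abs_def] D2h_def[abs_def] by (intro C2_add C2_minus C2)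
  have "open (N \<inter> \<Omega>)" "x \<in> N \<inter> \<Omega>" using assms by auto
  then obtain d where "d > 0" and d: "ball x d \<subseteq> N \<inter> \<Omega>"
    by (meson openE)
  have min: "h x \<le> h y" if "dist y x < d" for y
    using N(3)[of y] d that by (auto simp: h_def dist_commute subset_iff)
  have on_line: "dist (x + t *\<^sub>R v) x < d" if "\<bar>t\<bar> < d / (norm v + 1)" for t v
  proof -
    have "norm v + 1 > 0" by (simp add: add_nonneg_pos)
    have "\<bar>t\<bar> * norm v \<le> \<bar>t\<bar> * (norm v + 1)" by (intro mult_left_mono) auto
    also have "\<dots> < d" using that \<open>norm v + 1 > 0\<close> by (simp add: field_simps)
    finally show ?thesis by (simp add: dist_norm)
  qed
  have in\<Omega>: "x + t *\<^sub>R v \<in> \<Omega>" if "\<bar>t\<bar> < d / (norm v + 1)" for t v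
    using d on_line[OF that] by (auto simp: dist_commute subset_iff)
  have dpos: "d / (norm v + 1) > 0" for v :: "real^'n"
    using \<open>d > 0\<close> by (simp add: add_nonneg_pos)
  have D0: "v \<bullet> Dh x = 0" for v
  proof -
    have "((\<lambda>t. h (x + t *\<^sub>R v)) has_real_derivative v \<bullet> Dh (x + 0 *\<^sub>R v)) (at 0)"
      using \<open>x \<in> \<Omega>\<close> by (intro C2_line_deriv1[OF C]) simp
    then show ?thesis
      using DERIV_local_min[of "\<lambda>t. h (x + t *\<^sub>R v)" "v \<bullet> Dh x" 0 "d / (norm v + 1)"]
        dpos[of v] min on_line by simp
  qed
  then have "Dh x \<bullet> Dh x = 0" by blast
  then show "D\<psi> x = D\<phi> x" by (simp add: Dh_def)
  have pos: "v \<bullet> (D2h x *v v) \<ge> 0" for v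
  proof (rule ccontr)
    assume neg: "\<not> ?thesis"
    have "((\<lambda>t. v \<bullet> Dh (x + t *\<^sub>R v)) has_real_derivative v \<bullet> (D2h (x + 0 *\<^sub>R v) *v v)) (at 0)"
      using \<open>x \<in> \<Omega>\<close> by (intro C2_line_deriv2[OF C]) simp
    \<comment> \<open>A negative second derivative makes the directional derivative negative just to
      the right of 0, and the mean value theorem then produces a value of \<open>h\<close> below the
      minimum.\<close>
    from DERIV_neg_dec_right[OF this] neg obtain c where "c > 0"
      and c: "\<And>t. 0 < t \<Longrightarrow> t < c \<Longrightarrow> v \<bullet> Dh (x + t *\<^sub>R v) < v \<bullet> Dh x"
      by auto
    obtain t where t: "0 < t" "t < c" "t < d / (norm v + 1)"
      using \<open>c > 0\<close> dpos[of v] dense[of 0 "min c (d / (norm v + 1))"] by auto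
    have "((\<lambda>t. h (x + t *\<^sub>R v)) has_real_derivative v \<bullet> Dh (x + s *\<^sub>R v)) (at s)"
      if "0 \<le> s" "s \<le> t" for s
      using that t in\<Omega>[of s] by (intro C2_line_deriv1[OF C]) simp
    from MVT2[OF \<open>0 < t\<close> this] obtain s where s: "0 < s" "s < t"
      "h (x + t *\<^sub>R v) - h (x + 0 *\<^sub>R v) = (t - 0) * (v \<bullet> Dh (x + s *\<^sub>R v))" by blast
    have "v \<bullet> Dh (x + s *\<^sub>R v) < 0" using c[of s] s t D0 by simp
    then have "t * (v \<bullet> Dh (x + s *\<^sub>R v)) < 0"
      using t by (simp add: mult_pos_neg)
    then have "h (x + t *\<^sub>R v) < h x"
      using s by simp
    moreover have "h x \<le> h (x + t *\<^sub>R v)" using t by (intro min on_line) simp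
    ultimately show False by simp
  qed
  show "matrix_le (D2\<phi> x) (D2\<psi> x)"
    unfolding matrix_le_def
  proof
    fix v
    show "v \<bullet> (D2\<phi> x *v v) \<le> v \<bullet> (D2\<psi> x *v v)"
      using pos[of v] by (simp add: D2h_def matrix_vector_mult_diff_rdistrib inner_diff_right)
  qed
qed

section \<open>Semicontinuous envelopes\<close>

lemma bounded_image_realD:
  fixes f :: "'a \<Rightarrow> real"
  assumes "bounded (f ` S)"
  obtains B where "\<And>x. x \<in> S \<Longrightarrow> \<bar>f x\<bar> \<le> B"
  using assms that unfolding bounded_iff by (metis imageI real_norm_def)

lemma bounded_image_between:
  fixes f g h :: "'a \<Rightarrow> real"
  assumes "bounded (g ` S)" "bounded (h ` S)" "\<And>x. x \<in> S \<Longrightarrow> g x \<le> f x \<and> f x \<le> h x"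
  shows "bounded (f ` S)"
proof -
  obtain B where B: "\<And>x. x \<in> S \<Longrightarrow> \<bar>g x\<bar> \<le> B" using bounded_image_realD[OF assms(1)] by blast
  obtain C where C: "\<And>x. x \<in> S \<Longrightarrow> \<bar>h x\<bar> \<le> C" using bounded_image_realD[OF assms(2)] by blast
  have "\<bar>f x\<bar> \<le> max B C" if "x \<in> S" for x
    using B[OF that] C[OF that] assms(3)[OF that] by linarith
  then show ?thesis unfolding bounded_iff by auto
qed

text \<open>\<open>real_of_ereal\<close> sends infinite values to 0, so the envelope is the true
  limit superior only if that is finite. The bound on \<open>f\<close> gives this, once the filter
  is known to be nontrivial, which holds because \<open>x\<close> itself belongs to
  \<Omega>.\<close>

lemma Limsup_eq_usc_env:
  assumes "bounded (f ` \<Omega>)" "x \<in> \<Omega>"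
  shows "Limsup (inf (nhds x) (principal \<Omega>)) (\<lambda>y. ereal (f y)) = ereal (usc_env \<Omega> f x)"
proof -
  let ?F = "inf (nhds x) (principal \<Omega>)"
  obtain B where B: "\<And>x. x \<in> \<Omega> \<Longrightarrow> \<bar>f x\<bar> \<le> B" using bounded_image_realD[OF assms(1)] by blast
  have nontriv: "?F \<noteq> bot"
    using \<open>x \<in> \<Omega>\<close> eventually_nhds_x_imp_x
    by (force simp: trivial_limit_def eventually_inf_principal)
  have "\<forall>\<^sub>F y in ?F. ereal (- B) \<le> ereal (f y) \<and> ereal (f y) \<le> ereal B"
    using B by (auto simp: eventually_inf_principal abs_le_iff intro!: always_eventually)
       (metis B abs_le_D2 minus_le_iff)
  then have "ereal (- B) \<le> Limsup ?F (\<lambda>y. ereal (f y))" "Limsup ?F (\<lambda>y. ereal (f y)) \<le> ereal B"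
    by (auto intro!: Limsup_bounded le_Limsup[OF nontriv] elim: eventually_mono)
  then show ?thesis
    unfolding usc_env_def by (cases "Limsup ?F (\<lambda>y. ereal (f y))") auto
qed

lemma usc_env_lessD:
  assumes "bounded (f ` \<Omega>)" "x \<in> \<Omega>" "usc_env \<Omega> f x < c"
  obtains d where "d > 0" "\<And>y. y \<in> \<Omega> \<Longrightarrow> dist y x < d \<Longrightarrow> f y < c"
proof -
  have "\<forall>\<^sub>F y in inf (nhds x) (principal \<Omega>). ereal (f y) < ereal c"
    using assms by (intro Limsup_lessD) (simp add: Limsup_eq_usc_env)
  then show ?thesis
    using that unfolding eventually_inf_principal eventually_nhds_metric by auto
qed

lemma usc_env_leI:
  assumes "bounded (f ` \<Omega>)" "x \<in> \<Omega>" "d > 0" "\<And>y. y \<in> \<Omega> \<Longrightarrow> dist y x < d \<Longrightarrow> f y \<le> c"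
  shows "usc_env \<Omega> f x \<le> c"
proof -
  have "\<forall>\<^sub>F y in inf (nhds x) (principal \<Omega>). ereal (f y) \<le> ereal c"
    using assms unfolding eventually_inf_principal eventually_nhds_metric by auto
  then have "Limsup (inf (nhds x) (principal \<Omega>)) (\<lambda>y. ereal (f y)) \<le> ereal c"
    by (rule Limsup_bounded)
  then show ?thesis using assms by (simp add: Limsup_eq_usc_env)
qed

lemma usc_env_greaterD:
  assumes "bounded (f ` \<Omega>)" "x \<in> \<Omega>" "c < usc_env \<Omega> f x" "d > 0"
  obtains y where "y \<in> \<Omega>" "dist y x < d" "c < f y"
  using usc_env_leI[OF assms(1,2,4), of c] assms(3) that by (meson not_le)

lemma le_usc_env:
  assumes "bounded (f ` \<Omega>)" "x \<in> \<Omega>"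
  shows "f x \<le> usc_env \<Omega> f x"
proof (rule ccontr)
  assume "\<not> ?thesis"
  then obtain d where "d > 0" "\<And>y. y \<in> \<Omega> \<Longrightarrow> dist y x < d \<Longrightarrow> f y < f x"
    using usc_env_lessD[OF assms, of "f x"] by auto
  then show False using \<open>x \<in> \<Omega>\<close> by fastforce
qed

lemma usc_env_less_nearby:
  assumes "bounded (f ` \<Omega>)" "x \<in> \<Omega>" "usc_env \<Omega> f x < c"
  shows "\<forall>\<^sub>F y in nhds x. y \<in> \<Omega> \<longrightarrow> usc_env \<Omega> f y < c"
proof -
  \<comment> \<open>The room between \<open>c'\<close> and \<open>c\<close> is needed because a
    strict bound on \<open>f\<close> passes to the envelope only as a weak one.\<close>
  obtain c' where c': "usc_env \<Omega> f x < c'" "c' < c" using assms(3) dense by blast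
  obtain d where d: "d > 0" "\<And>y. y \<in> \<Omega> \<Longrightarrow> dist y x < d \<Longrightarrow> f y < c'"
    using usc_env_lessD[OF assms(1,2) c'(1)] by blast
  have "usc_env \<Omega> f y \<le> c'" if y: "y \<in> \<Omega>" "dist y x < d / 2" for y
  proof (rule usc_env_leI[OF assms(1) y(1), of "d / 2"])
    fix z assume "z \<in> \<Omega>" "dist z y < d / 2"
    then show "f z \<le> c'" using y d(2)[of z] dist_triangle_half_l[of z y d x]
      by (simp add: dist_commute less_imp_le)
  qed (use d in simp)
  then show ?thesis
    using d(1) c'(2) unfolding eventually_nhds_metric
    by (intro exI[of _ "d / 2"]) (auto intro: le_less_trans)
qed

lemma usc_env_mono:
  assumes "bounded (f ` \<Omega>)" "bounded (g ` \<Omega>)" "x \<in> \<Omega>" "\<And>y. y \<in> \<Omega> \<Longrightarrow> f y \<le> g y"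
  shows "usc_env \<Omega> f x \<le> usc_env \<Omega> g x"
proof (rule dense_ge)
  fix c assume "usc_env \<Omega> g x < c"
  then obtain d where d: "d > 0" "\<And>y. y \<in> \<Omega> \<Longrightarrow> dist y x < d \<Longrightarrow> g y < c"
    using usc_env_lessD[OF assms(2,3)] by blast
  show "usc_env \<Omega> f x \<le> c"
    using assms(4) d(2) by (intro usc_env_leI[OF assms(1,3) d(1)]) (meson less_imp_le order_trans)
qed

text \<open>Lets facts about lower envelopes be read off from those about upper envelopes of
  \<open>- f\<close>. No boundedness is assumed because \<open>real_of_ereal\<close> is odd, also at
  infinite values.\<close>

lemma lsc_env_eq_usc_env: "lsc_env \<Omega> f x = - usc_env \<Omega> (\<lambda>y. - f y) x"
proof -
  have "Limsup F (\<lambda>y. ereal (- f y)) = - Liminf F (\<lambda>y. ereal (f y))" for F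
    using ereal_Limsup_uminus[of F "\<lambda>y. ereal (f y)"] by simp
  then show ?thesis by (simp add: usc_env_def lsc_env_def)
qed

lemma bounded_uminus_image:
  fixes f :: "'a \<Rightarrow> real"
  shows "bounded (f ` S) \<Longrightarrow> bounded ((\<lambda>x. - f x) ` S)"
  using bounded_uminus[of "f ` S"] by (simp add: image_image)

lemma lsc_env_geI:
  assumes "bounded (f ` \<Omega>)" "x \<in> \<Omega>" "d > 0" "\<And>y. y \<in> \<Omega> \<Longrightarrow> dist y x < d \<Longrightarrow> c \<le> f y"
  shows "c \<le> lsc_env \<Omega> f x"
  using usc_env_leI[OF bounded_uminus_image[OF assms(1)] assms(2,3), of "- c"] assms(4)
  by (simp add: lsc_env_eq_usc_env)

lemma lsc_env_le:
  assumes "bounded (f ` \<Omega>)" "x \<in> \<Omega>"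
  shows "lsc_env \<Omega> f x \<le> f x"
  using le_usc_env[OF bounded_uminus_image[OF assms(1)] assms(2)]
  by (simp add: lsc_env_eq_usc_env)

lemma lsc_env_greater_nearby:
  assumes "bounded (f ` \<Omega>)" "x \<in> \<Omega>" "c < lsc_env \<Omega> f x"
  shows "\<forall>\<^sub>F y in nhds x. y \<in> \<Omega> \<longrightarrow> c < lsc_env \<Omega> f y"
proof -
  have "usc_env \<Omega> (\<lambda>y. - f y) x < - c" using assms(3) by (simp add: lsc_env_eq_usc_env)
  from usc_env_less_nearby[OF bounded_uminus_image[OF assms(1)] assms(2) this]
  show ?thesis by (simp add: lsc_env_eq_usc_env less_minus_iff)
qed

lemma lsc_env_mono:
  assumes "bounded (f ` \<Omega>)" "bounded (g ` \<Omega>)" "x \<in> \<Omega>" "\<And>y. y \<in> \<Omega> \<Longrightarrow> f y \<le> g y"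
  shows "lsc_env \<Omega> f x \<le> lsc_env \<Omega> g x"
  using usc_env_mono[OF assms(2,1)[THEN bounded_uminus_image] assms(3)] assms(4)
  by (simp add: lsc_env_eq_usc_env)

text \<open>If no maximum exists, the relatively open sets where \<open>g\<close> is below one of
  its own values cover \<open>K\<close>. In a finite subcover the largest of the chosen values is
  attained at a point of \<open>K\<close>, which is then covered by no member.\<close>

lemma usc_attains_max:
  fixes g :: "'a::metric_space \<Rightarrow> real"
  assumes "compact K" "K \<noteq> {}"
    and usc: "\<And>x c. x \<in> K \<Longrightarrow> g x < c \<Longrightarrow> \<forall>\<^sub>F y in nhds x. y \<in> K \<longrightarrow> g y < c"
  shows "\<exists>x\<in>K. \<forall>y\<in>K. g y \<le> g x"
proof (rule ccontr)
  assume no_max: "\<not> ?thesis"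
  \<comment> \<open>\<open>T z\<close> is an open set of the whole space whose trace on
    \<open>K\<close> is the set where \<open>g\<close> is less than \<open>g z\<close>.\<close>
  define T where "T z = (\<Union>x\<in>{x\<in>K. g x < g z}. \<Union>d\<in>{d. d > 0 \<and> (\<forall>y\<in>K. dist y x < d \<longrightarrow> g y < g z)}. ball x d)" for z
  have op: "open (T z)" for z by (auto simp: T_def)
  have T_less: "g y < g z" if "y \<in> K" "y \<in> T z" for y z
    using that by (auto simp: T_def dist_commute)
  have cov: "K \<subseteq> (\<Union>z\<in>K. T z)"
  proof
    fix x assume "x \<in> K"
    then obtain z where "z \<in> K" "g x < g z" using no_max by (meson not_less)
    moreover obtain d where "d > 0" "\<forall>y\<in>K. dist y x < d \<longrightarrow> g y < g z"
      using usc[OF \<open>x \<in> K\<close> \<open>g x < g z\<close>] unfolding eventually_nhds_metric by blast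
    ultimately have "x \<in> T z" unfolding T_def using \<open>x \<in> K\<close> by (auto intro!: bexI[of _ x] exI[of _ d])
    then show "x \<in> (\<Union>z\<in>K. T z)" using \<open>z \<in> K\<close> by blast
  qed
  obtain C where C: "C \<subseteq> K" "finite C" "K \<subseteq> (\<Union>z\<in>C. T z)"
    using compactE_image[OF \<open>compact K\<close> op cov] by blast
  have "C \<noteq> {}" using C \<open>K \<noteq> {}\<close> by auto
  then have "Max (g ` C) \<in> g ` C" using C(2) by simp
  then obtain z where "z \<in> C" "g z = Max (g ` C)" by force
  then have z: "z \<in> C" "\<And>w. w \<in> C \<Longrightarrow> g w \<le> g z"
    using C(2) by auto
  then obtain w where "w \<in> C" "z \<in> T w" using C by blast
  then show False using T_less[of z w] z C by fastforce
qed

lemma continuous_on_nearby: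
  fixes f :: "'a::metric_space \<Rightarrow> 'b::metric_space"
  assumes "continuous_on \<Omega> f" "x \<in> \<Omega>" "e > 0"
  shows "\<forall>\<^sub>F y in nhds x. y \<in> \<Omega> \<longrightarrow> dist (f y) (f x) < e"
  using assms unfolding continuous_on_iff eventually_nhds_metric by metis

section \<open>Perron's method for quasi-monotone systems\<close>

lemma env_vec_in_Rvec: "usc_env_vec m \<Omega> u x \<in> Rvec m" "lsc_env_vec m \<Omega> u x \<in> Rvec m"
  by (simp_all add: usc_env_vec_def lsc_env_vec_def Rvec_def)

definition subsolution ::
  "(real^'n) set \<Rightarrow> nat \<Rightarrow> (nat \<Rightarrow> real^'n \<Rightarrow> (nat \<Rightarrow> real) \<Rightarrow> real^'n \<Rightarrow> real^'n^'n \<Rightarrow> real) \<Rightarrow>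
     (real^'n \<Rightarrow> nat \<Rightarrow> real) \<Rightarrow> bool" where
  "subsolution \<Omega> m G u \<longleftrightarrow>
     (\<forall>x\<in>\<Omega>. \<forall>i<m. \<forall>\<phi> D\<phi> D2\<phi>.
        C2_with_derivs \<Omega> \<phi> D\<phi> D2\<phi> \<and> touches_above \<Omega> \<phi> (usc_env \<Omega> (\<lambda>y. u y i)) x \<longrightarrow>
        G i x (usc_env_vec m \<Omega> u x) (D\<phi> x) (D2\<phi> x) \<le> 0)"

definition supersolution ::
  "(real^'n) set \<Rightarrow> nat \<Rightarrow> (nat \<Rightarrow> real^'n \<Rightarrow> (nat \<Rightarrow> real) \<Rightarrow> real^'n \<Rightarrow> real^'n^'n \<Rightarrow> real) \<Rightarrow>
     (real^'n \<Rightarrow> nat \<Rightarrow> real) \<Rightarrow> bool" where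
  "supersolution \<Omega> m G u \<longleftrightarrow>
     (\<forall>x\<in>\<Omega>. \<forall>i<m. \<forall>\<phi> D\<phi> D2\<phi>.
        C2_with_derivs \<Omega> \<phi> D\<phi> D2\<phi> \<and> touches_below \<Omega> \<phi> (lsc_env \<Omega> (\<lambda>y. u y i)) x \<longrightarrow>
        G i x (lsc_env_vec m \<Omega> u x) (D\<phi> x) (D2\<phi> x) \<ge> 0)"

lemma quartic_eq_dist: "((y - a) \<bullet> (y - a))\<^sup>2 = (dist y a) ^ 4"
  by (simp add: dist_norm dot_square_norm flip: power_mult)

text \<open>The definition tests only with strict contact and equal values, while maximisation over
  a compact set yields neither. The quartic makes the maximum strict without changing the jet at
  \<open>x\<close>, and a constant adjusts the value.\<close>

lemma subsolution_weak_test: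
  fixes x :: "real^'n"
  assumes "subsolution \<Omega> m G u" "x \<in> \<Omega>" "i < m" and C2: "C2_with_derivs \<Omega> \<phi> D\<phi> D2\<phi>"
    and N: "open N" "x \<in> N"
      "\<And>y. y \<in> N \<inter> \<Omega> \<Longrightarrow> usc_env \<Omega> (\<lambda>y. u y i) y - \<phi> y \<le> usc_env \<Omega> (\<lambda>y. u y i) x - \<phi> x"
  shows "G i x (usc_env_vec m \<Omega> u x) (D\<phi> x) (D2\<phi> x) \<le> 0"
proof -
  obtain D\<psi> D2\<psi> where \<psi>: "C2_with_derivs \<Omega> (\<lambda>y. \<phi> y + ((y - x) \<bullet> (y - x))\<^sup>2) D\<psi> D2\<psi>"
    "D\<psi> x = D\<phi> x" "D2\<psi> x = D2\<phi> x"
    using C2_perturb_quartic[OF C2] by blast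
  let ?\<psi> = "\<lambda>y. \<phi> y + ((y - x) \<bullet> (y - x))\<^sup>2 + (usc_env \<Omega> (\<lambda>y. u y i) x - \<phi> x)"
  have "touches_above \<Omega> ?\<psi> (usc_env \<Omega> (\<lambda>y. u y i)) x"
    unfolding touches_above_def
  proof (intro conjI exI[of _ N] ballI)
    fix y assume y: "y \<in> N \<inter> \<Omega> - {x}"
    then have "((y - x) \<bullet> (y - x))\<^sup>2 > 0" by simp
    moreover have "usc_env \<Omega> (\<lambda>y. u y i) y - \<phi> y \<le> usc_env \<Omega> (\<lambda>y. u y i) x - \<phi> x"
      using N(3) y by blast
    ultimately show "usc_env \<Omega> (\<lambda>y. u y i) y < ?\<psi> y" by linarith
  qed (use N in auto)
  with C2_add_const[OF \<psi>(1)] show ?thesis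
    using assms(1-3) unfolding subsolution_def \<psi>(2,3)[symmetric] by blast
qed

locale quasi_monotone_system =
  fixes \<Omega> :: "(real^'n) set" and m :: nat
    and G :: "nat \<Rightarrow> real^'n \<Rightarrow> (nat \<Rightarrow> real) \<Rightarrow> real^'n \<Rightarrow> real^'n^'n \<Rightarrow> real"
  assumes open_domain: "open \<Omega>"
    and continuous: "i < m \<Longrightarrow>
      continuous_on (\<Omega> \<times> Rvec m \<times> UNIV \<times> sym_matrices) (\<lambda>(x, r, p, X). G i x r p X)"
    and elliptic: "i < m \<Longrightarrow> x \<in> \<Omega> \<Longrightarrow> r \<in> Rvec m \<Longrightarrow> X \<in> sym_matrices \<Longrightarrow> Y \<in> sym_matrices \<Longrightarrow>
      matrix_le X Y \<Longrightarrow> G i x r p Y \<le> G i x r p X"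
    and quasi_monotone: "i < m \<Longrightarrow> x \<in> \<Omega> \<Longrightarrow> r \<in> Rvec m \<Longrightarrow> \<rho> \<in> Rvec m \<Longrightarrow> X \<in> sym_matrices \<Longrightarrow>
      vec_le m r \<rho> \<Longrightarrow> r i = \<rho> i \<Longrightarrow> G i x \<rho> p X \<le> G i x r p X"
begin

text \<open>Continuity in the form used below, with closeness of vectors measured in the components
  below \<open>m\<close> instead of the product metric of \<open>nat \<Rightarrow> real\<close>. The
  argument is sequential because convergence in the product topology is componentwise.\<close>

lemma nearby:
  assumes "i < m" "x \<in> \<Omega>" "r \<in> Rvec m" "X \<in> sym_matrices" "\<epsilon> > 0"
  shows "\<exists>e>0. \<forall>x'\<in>\<Omega>. \<forall>r'\<in>Rvec m. \<forall>p'. \<forall>X'\<in>sym_matrices. dist x' x < e \<longrightarrow>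
    (\<forall>j<m. \<bar>r' j - r j\<bar> < e) \<longrightarrow> dist p' p < e \<longrightarrow> dist X' X < e \<longrightarrow>
    \<bar>G i x' r' p' X' - G i x r p X\<bar> < \<epsilon>"
proof (rule ccontr)
  assume contra: "\<not> ?thesis"
  define P where "P e q = (case q of (x', r', p', X') \<Rightarrow> x' \<in> \<Omega> \<and> r' \<in> Rvec m \<and> X' \<in> sym_matrices \<and>
    dist x' x < e \<and> (\<forall>j<m. \<bar>r' j - r j\<bar> < e) \<and> dist p' p < e \<and> dist X' X < e \<and>
    \<not> \<bar>G i x' r' p' X' - G i x r p X\<bar> < \<epsilon>)" for e q
  have "\<exists>q. P (inverse (real (Suc n))) q" for n
  proof (rule ccontr)
    assume no: "\<not> ?thesis"
    have "\<not> P (inverse (real (Suc n))) (x', r', p', X')" for x' r' p' X'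
      using no by blast
    then show False
      using contra unfolding P_def prod.case by (meson inverse_positive_iff_positive of_nat_0_less_iff zero_less_Suc)
  qed
  then obtain q where q: "P (inverse (real (Suc n))) (q n)" for n by metis
  define x' r' p' X' where "x' n = fst (q n)" and "r' n = fst (snd (q n))"
    and "p' n = fst (snd (snd (q n)))" and "X' n = snd (snd (snd (q n)))" for n
  have P': "P (inverse (real (Suc n))) (x' n, r' n, p' n, X' n)" for n
    using q[of n] by (simp add: x'_def r'_def p'_def X'_def)
  have in_dom: "\<And>n. x' n \<in> \<Omega> \<and> r' n \<in> Rvec m \<and> X' n \<in> sym_matrices"
    and lim: "\<And>n. dist (x' n) x < inverse (real (Suc n))"
      "\<And>n j. j < m \<Longrightarrow> \<bar>r' n j - r j\<bar> < inverse (real (Suc n))"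
      "\<And>n. dist (p' n) p < inverse (real (Suc n))" "\<And>n. dist (X' n) X < inverse (real (Suc n))"
    and far: "\<And>n. \<not> \<bar>G i (x' n) (r' n) (p' n) (X' n) - G i x r p X\<bar> < \<epsilon>"
    using P' unfolding P_def prod.case by blast+
  have to_lim: "f \<longlonglongrightarrow> l" if f: "\<And>n. dist (f n) l < inverse (real (Suc n))"
    for f :: "nat \<Rightarrow> 'b::metric_space" and l
  proof (rule metric_tendsto_imp_tendsto[OF LIMSEQ_inverse_real_of_nat always_eventually], rule allI)
    fix n
    have "dist (f n) l \<le> inverse (real (Suc n))" using f[of n] by (rule less_imp_le)
    then show "dist (f n) l \<le> dist (inverse (real (Suc n))) 0" by simp
  qed
  have r': "r' \<longlonglongrightarrow> r"
  proof -
    have "(\<lambda>n. r' n j) \<longlonglongrightarrow> r j" for j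
    proof (cases "j < m")
      case True
      then show ?thesis using lim(2) by (intro to_lim) (simp add: dist_real_def)
    next
      case False
      \<comment> \<open>Beyond \<open>m\<close> both extensional vectors take the same default
        value.\<close>
      then have "r' n j = r j" for n
        using in_dom[of n] assms(3) by (auto simp: Rvec_def PiE_def extensional_def)
      then show ?thesis by simp
    qed
    then show ?thesis
      using limitin_componentwise[of "\<lambda>_. euclidean" UNIV r' r sequentially]
      by (simp add: euclidean_product_topology)
  qed
  have "(\<lambda>n. (x' n, r' n, p' n, X' n)) \<longlonglongrightarrow> (x, r, p, X)"
    by (intro tendsto_Pair r' to_lim lim)
  then have "(\<lambda>n. (\<lambda>(x, r, p, X). G i x r p X) (x' n, r' n, p' n, X' n)) \<longlonglongrightarrow> (\<lambda>(x, r, p, X). G i x r p X) (x, r, p, X)"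
    using assms in_dom
    by (intro continuous_on_tendsto_compose[OF continuous]) auto
  then have "\<forall>\<^sub>F n in sequentially. dist (G i (x' n) (r' n) (p' n) (X' n)) (G i x r p X) < \<epsilon>"
    using \<open>\<epsilon> > 0\<close> by (simp add: tendstoD)
  then show False using far by (simp add: dist_real_def)
qed

section \<open>Stability of subsolutions under suprema\<close>

text \<open>A single member \<open>v\<close> that is nearly optimal close to the contact point
  already yields the contradiction: the quartic forces the maximum of its envelope minus \<psi> to
  lie near \<open>x\<close>, with a value close to that of \<open>u\<close>. No sequence of members
  is required.\<close>

lemma subsolution_Sup:
  assumes "S \<noteq> {}"
    and sub: "\<And>v. v \<in> S \<Longrightarrow> subsolution \<Omega> m G v"
    and bnd: "\<And>i. i < m \<Longrightarrow> \<exists>B. \<forall>v\<in>S. \<forall>x\<in>\<Omega>. \<bar>v x i\<bar> \<le> B"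
    and u: "\<And>x i. x \<in> \<Omega> \<Longrightarrow> i < m \<Longrightarrow> u x i = (SUP v\<in>S. v x i)"
  shows "subsolution \<Omega> m G u"
proof -
  have bdd: "bdd_above ((\<lambda>v. v x i) ` S)" if "x \<in> \<Omega>" "i < m" for x i
    using bnd[OF that(2)] that(1) by (force simp: bdd_above_def abs_le_iff)
  have le: "v x i \<le> u x i" if "v \<in> S" "x \<in> \<Omega>" "i < m" for v x i
    unfolding u[OF that(2,3)] using that bdd by (intro cSUP_upper)
  have vb: "bounded ((\<lambda>x. v x i) ` \<Omega>)" if "v \<in> S" "i < m" for v i
    using bnd[OF that(2)] that(1) unfolding bounded_iff by auto
  have ub: "bounded ((\<lambda>x. u x i) ` \<Omega>)" if i: "i < m" for i
  proof -
    obtain B where B: "\<And>v x. v \<in> S \<Longrightarrow> x \<in> \<Omega> \<Longrightarrow> \<bar>v x i\<bar> \<le> B" using bnd[OF i] by blast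
    obtain v where "v \<in> S" using \<open>S \<noteq> {}\<close> by blast
    have "\<bar>u x i\<bar> \<le> B" if "x \<in> \<Omega>" for x
    proof -
      have "u x i \<le> B" unfolding u[OF that \<open>i < m\<close>]
        using B that \<open>S \<noteq> {}\<close> by (intro cSUP_least) (auto simp: abs_le_iff)
      moreover have "- B \<le> u x i"
        using le[OF \<open>v \<in> S\<close> that \<open>i < m\<close>] B[OF \<open>v \<in> S\<close> that] by linarith
      ultimately show ?thesis by linarith
    qed
    then show ?thesis unfolding bounded_iff by auto
  qed
  show ?thesis
    unfolding subsolution_def
  proof (intro ballI allI impI; elim conjE; rule ccontr)
    fix x i \<phi> D\<phi> D2\<phi>
    assume x: "x \<in> \<Omega>" and i: "i < m" and C2: "C2_with_derivs \<Omega> \<phi> D\<phi> D2\<phi>"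
      and touch: "touches_above \<Omega> \<phi> (usc_env \<Omega> (\<lambda>y. u y i)) x"
      and "\<not> G i x (usc_env_vec m \<Omega> u x) (D\<phi> x) (D2\<phi> x) \<le> 0"
    then have pos: "G i x (usc_env_vec m \<Omega> u x) (D\<phi> x) (D2\<phi> x) > 0" by simp
    define r where "r = usc_env_vec m \<Omega> u x"
    have r: "r \<in> Rvec m" and r_eq: "\<And>j. j < m \<Longrightarrow> r j = usc_env \<Omega> (\<lambda>y. u y j) x"
      by (simp_all add: r_def env_vec_in_Rvec) (simp add: usc_env_vec_def)
    define \<psi> where "\<psi> y = \<phi> y + ((y - x) \<bullet> (y - x))\<^sup>2" for y
    obtain D\<psi> D2\<psi> where C2\<psi>: "C2_with_derivs \<Omega> \<psi> D\<psi> D2\<psi>"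
      and eq: "D\<psi> x = D\<phi> x" "D2\<psi> x = D2\<phi> x"
      using C2_perturb_quartic[OF C2] unfolding \<psi>_def[abs_def] by blast
    have symm: "D2\<psi> y \<in> sym_matrices" if "y \<in> \<Omega>" for y
      using C2_hessian_symmetric[OF C2\<psi> open_domain that] .
    obtain N where N: "open N" "x \<in> N" "\<And>y. y \<in> N \<inter> \<Omega> \<Longrightarrow> usc_env \<Omega> (\<lambda>y. u y i) y \<le> \<phi> y"
      and x_eq: "\<phi> x = usc_env \<Omega> (\<lambda>y. u y i) x"
      using touch unfolding touches_above_def by (metis DiffI less_imp_le order_refl singletonD)
    \<comment> \<open>The tolerance is the positive value of \<open>G\<close> itself, so all values
      at nearby arguments remain positive.\<close>
    obtain e where "e > 0" and e: "\<And>x' r' p' X'. x' \<in> \<Omega> \<Longrightarrow> r' \<in> Rvec m \<Longrightarrow> X' \<in> sym_matrices \<Longrightarrow>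
        dist x' x < e \<Longrightarrow> (\<forall>j<m. \<bar>r' j - r j\<bar> < e) \<Longrightarrow> dist p' (D\<psi> x) < e \<Longrightarrow> dist X' (D2\<psi> x) < e \<Longrightarrow>
        \<bar>G i x' r' p' X' - G i x r (D\<psi> x) (D2\<psi> x)\<bar> < G i x r (D\<psi> x) (D2\<psi> x)"
      using nearby[OF i x r symm[OF x], of "G i x r (D\<psi> x) (D2\<psi> x)" "D\<psi> x"] pos
      unfolding eq r_def by blast
    have "\<forall>\<^sub>F y in nhds x. y \<in> \<Omega> \<and> y \<in> N"
      using open_domain x N by (intro eventually_conj eventually_nhds_in_open)
    moreover have "\<forall>\<^sub>F y in nhds x. \<forall>j\<in>{..<m}. y \<in> \<Omega> \<longrightarrow> usc_env \<Omega> (\<lambda>y. u y j) y < r j + e"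
      using \<open>e > 0\<close> x by (intro eventually_ball_finite ballI usc_env_less_nearby ub) (auto simp: r_eq)
    moreover have "\<forall>\<^sub>F y in nhds x. y \<in> \<Omega> \<longrightarrow> dist (\<psi> y) (\<psi> x) < e / 2"
      "\<forall>\<^sub>F y in nhds x. y \<in> \<Omega> \<longrightarrow> dist (D\<psi> y) (D\<psi> x) < e" "\<forall>\<^sub>F y in nhds x. y \<in> \<Omega> \<longrightarrow> dist (D2\<psi> y) (D2\<psi> x) < e"
      using C2_continuous_on[OF C2\<psi>] x \<open>e > 0\<close> by - (rule continuous_on_nearby; simp)+
    moreover have "\<forall>\<^sub>F y in nhds x. dist y x < e"
      using \<open>e > 0\<close> unfolding eventually_nhds_metric by blast
    ultimately have "\<forall>\<^sub>F y in nhds x. y \<in> \<Omega> \<and> y \<in> N \<and> (\<forall>j<m. usc_env \<Omega> (\<lambda>y. u y j) y < r j + e) \<and>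
        dist (\<psi> y) (\<psi> x) < e / 2 \<and> dist (D\<psi> y) (D\<psi> x) < e \<and> dist (D2\<psi> y) (D2\<psi> x) < e \<and> dist y x < e"
      by eventually_elim auto
    then obtain d where "d > 0" and d: "\<And>y. dist y x < d \<Longrightarrow> y \<in> \<Omega> \<and> y \<in> N \<and>
        (\<forall>j<m. usc_env \<Omega> (\<lambda>y. u y j) y < r j + e) \<and>
        dist (\<psi> y) (\<psi> x) < e / 2 \<and> dist (D\<psi> y) (D\<psi> x) < e \<and> dist (D2\<psi> y) (D2\<psi> x) < e \<and> dist y x < e"
      unfolding eventually_nhds_metric by blast
    \<comment> \<open>The bound \<open>e / 2\<close> is for the error in component \<open>i\<close>;
      \<open>(d / 2) ^ 4\<close> is the quartic gap on the boundary of the half ball and keeps the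
      maximum away from it.\<close>
    define \<eta> where "\<eta> = min (e / 2) ((d / 2) ^ 4)"
    have "\<eta> > 0" using \<open>d > 0\<close> \<open>e > 0\<close> by (simp add: \<eta>_def)
    obtain d' where "d' > 0" and d': "\<And>y. y \<in> \<Omega> \<Longrightarrow> dist y x < d' \<Longrightarrow> dist (\<psi> y) (\<psi> x) < \<eta> / 2"
      using C2_continuous_on(1)[OF C2\<psi>] x \<open>\<eta> > 0\<close> unfolding continuous_on_iff
      by (meson half_gt_zero)
    \<comment> \<open>The loss is shared: one half of \<eta> for replacing the envelope at
      \<open>x\<close> by one member at a point \<open>z\<close>, the other for the oscillation of
      \<psi> between \<open>x\<close> and \<open>z\<close>.\<close>
    have "\<psi> x - \<eta> / 2 < usc_env \<Omega> (\<lambda>y. u y i) x" using \<open>\<eta> > 0\<close> x_eq by (simp add: \<psi>_def)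
    then obtain z where z: "z \<in> \<Omega>" "dist z x < min (d / 2) d'" "\<psi> x - \<eta> / 2 < u z i"
      using usc_env_greaterD[OF ub[OF i] x, of _ "min (d / 2) d'"] \<open>d > 0\<close> \<open>d' > 0\<close>
      by (metis half_gt_zero min_less_iff_conj)
    then obtain v where v: "v \<in> S" "\<psi> x - \<eta> / 2 < v z i"
      using \<open>S \<noteq> {}\<close> bdd i unfolding u[OF z(1) i] by (subst (asm) less_cSUP_iff) auto
    let ?v = "usc_env \<Omega> (\<lambda>y. v y i)"
    have v_le: "usc_env \<Omega> (\<lambda>y. v y j) y \<le> usc_env \<Omega> (\<lambda>y. u y j) y" if "y \<in> \<Omega>" "j < m" for y j
      using that le v by (intro usc_env_mono vb ub) auto
    have sub_ball: "y \<in> \<Omega>" "dist y x < d" if "y \<in> cball x (d / 2)" for y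
      using that d[of y] \<open>d > 0\<close> by (auto simp: dist_commute)
    have "\<exists>y\<in>cball x (d / 2). \<forall>y'\<in>cball x (d / 2). ?v y' - \<psi> y' \<le> ?v y - \<psi> y"
    proof (rule usc_attains_max)
      fix y c assume y: "y \<in> cball x (d / 2)" and less: "?v y - \<psi> y < c"
      define h where "h = (c - (?v y - \<psi> y)) / 2"
      have "h > 0" using less by (simp add: h_def)
      have "\<forall>\<^sub>F y' in nhds y. y' \<in> \<Omega> \<longrightarrow> ?v y' < ?v y + h"
        using sub_ball[OF y] v i \<open>h > 0\<close> by (intro usc_env_less_nearby vb) auto
      moreover have "\<forall>\<^sub>F y' in nhds y. y' \<in> \<Omega> \<longrightarrow> dist (\<psi> y') (\<psi> y) < h"
        using C2_continuous_on(1)[OF C2\<psi>] sub_ball[OF y] \<open>h > 0\<close> by (intro continuous_on_nearby)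
      ultimately show "\<forall>\<^sub>F y' in nhds y. y' \<in> cball x (d / 2) \<longrightarrow> ?v y' - \<psi> y' < c"
      proof eventually_elim
        case (elim y')
        show ?case
        proof
          assume "y' \<in> cball x (d / 2)"
          then have "y' \<in> \<Omega>" by (rule sub_ball)
          with elim have "?v y' < ?v y + h" "\<bar>\<psi> y' - \<psi> y\<bar> < h" by (auto simp: dist_real_def)
          moreover have "c = ?v y - \<psi> y + 2 * h" by (simp add: h_def field_simps)
          ultimately show "?v y' - \<psi> y' < c" by linarith
        qed
      qed
    qed (use \<open>d > 0\<close> in auto)
    then obtain y where y: "y \<in> cball x (d / 2)"
      and max: "\<And>y'. y' \<in> cball x (d / 2) \<Longrightarrow> ?v y' - \<psi> y' \<le> ?v y - \<psi> y" by blast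
    note y\<Omega> = sub_ball[OF y] and dy = d[OF sub_ball(2)[OF y]]
    have "v z i \<le> ?v z" using le_usc_env[OF vb[OF v(1) i] z(1)] .
    moreover have "\<bar>\<psi> z - \<psi> x\<bar> < \<eta> / 2" using d'[OF z(1)] z(2) by (simp add: dist_real_def)
    moreover have "?v z - \<psi> z \<le> ?v y - \<psi> y" using z by (intro max) (simp add: dist_commute)
    ultimately have lower: "- \<eta> < ?v y - \<psi> y" using v(2) by linarith
    have "?v y \<le> \<phi> y" using v_le[OF y\<Omega>(1) i] N(3)[of y] dy by auto
    \<comment> \<open>The envelope of \<open>v\<close> lies below \<phi>, which is \<psi> minus the
      quartic. With \<open>lower\<close> this pushes the fourth power of the distance below \<eta>,
      so the maximum is interior and \<open>\<psi>\<close> is an admissible test at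
      \<open>y\<close>.\<close>
    then have upper: "?v y - \<psi> y \<le> - (dist y x ^ 4)" by (simp add: \<psi>_def quartic_eq_dist)
    with lower have "dist y x ^ 4 < (d / 2) ^ 4" by (simp add: \<eta>_def)
    then have "dist y x < d / 2" using power_less_imp_less_base[of "dist y x" 4 "d / 2"] \<open>d > 0\<close> by simp
    then have test: "G i y (usc_env_vec m \<Omega> v y) (D\<psi> y) (D2\<psi> y) \<le> 0"
      using max sub[OF v(1)] y\<Omega>(1) i C2\<psi>
      by (intro subsolution_weak_test[where N = "ball x (d / 2)"]) (auto simp: dist_commute)
    \<comment> \<open>Component \<open>i\<close> must agree with that of \<open>v\<close> for
      quasi-monotonicity to apply. The maximum puts each other component above that of
      \<open>v\<close> and also within \<open>e\<close> of \<open>r\<close>, as the envelope of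
      \<open>u\<close> at \<open>y\<close> may be far below \<open>r j\<close> but not far above
      it.\<close>
    define r' where "r' = (\<lambda>j\<in>{..<m}. if j = i then ?v y else max (usc_env \<Omega> (\<lambda>y. u y j) y) (r j))"
    have r': "r' \<in> Rvec m" by (simp add: r'_def Rvec_def)
    have "\<bar>r' j - r j\<bar> < e" if "j < m" for j
    proof (cases "j = i")
      case True
      have "dist y x ^ 4 \<ge> 0" by simp
      then have "?v y \<le> \<psi> y" "\<psi> y - e / 2 < ?v y" using upper lower unfolding \<eta>_def by linarith+
      moreover have "\<bar>\<psi> y - \<psi> x\<bar> < e / 2" using dy by (simp add: dist_real_def)
      ultimately have "\<bar>?v y - \<psi> x\<bar> < e" using \<open>e > 0\<close> by linarith
      moreover have "r i = \<psi> x" using r_eq[OF i] x_eq by (simp add: \<psi>_def)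
      ultimately show ?thesis using True i by (simp add: r'_def)
    next
      case False
      then show ?thesis using that dy \<open>e > 0\<close> by (auto simp: r'_def max_def abs_if)
    qed
    then have "\<bar>G i y r' (D\<psi> y) (D2\<psi> y) - G i x r (D\<psi> x) (D2\<psi> x)\<bar> < G i x r (D\<psi> x) (D2\<psi> x)"
      using dy y\<Omega> symm r' by (intro e) auto
    moreover have "G i y r' (D\<psi> y) (D2\<psi> y) \<le> G i y (usc_env_vec m \<Omega> v y) (D\<psi> y) (D2\<psi> y)"
    proof (rule quasi_monotone[OF i y\<Omega>(1) env_vec_in_Rvec(1) r' symm[OF y\<Omega>(1)]])
      show "vec_le m (usc_env_vec m \<Omega> v y) r'"
        using v_le[OF y\<Omega>(1)] by (auto simp: vec_le_def usc_env_vec_def r'_def le_max_iff_disj)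
      show "usc_env_vec m \<Omega> v y i = r' i" using i by (simp add: usc_env_vec_def r'_def)
    qed
    ultimately show False using test by linarith
  qed
qed

section \<open>Raising one component of a subsolution\<close>

text \<open>Subtracting the quartic puts \<psi> + \<delta> below component \<open>i\<close> of
  \<open>u\<close> outside a half ball, so cutting the maximum off at radius \<open>d\<close>
  creates no jump. Where the envelope really rises, the strict inequality for \<psi> takes over;
  elsewhere the old test still applies, because larger values of component \<open>i\<close> only
  lower the other equations.\<close>

lemma subsolution_bump:
  assumes sub: "subsolution \<Omega> m G u" and ub: "\<And>j. j < m \<Longrightarrow> bounded ((\<lambda>x. u x j) ` \<Omega>)"
    and zb: "bounded (z ` \<Omega>)"
    and x0: "x0 \<in> \<Omega>" and i: "i < m" and C2: "C2_with_derivs \<Omega> \<phi> D\<phi> D2\<phi>"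
    and touch: "touches_below \<Omega> \<phi> (lsc_env \<Omega> (\<lambda>y. u y i)) x0"
    and neg: "G i x0 (lsc_env_vec m \<Omega> u x0) (D\<phi> x0) (D2\<phi> x0) < 0"
    and below: "lsc_env \<Omega> (\<lambda>y. u y i) x0 < lsc_env \<Omega> z x0"
  obtains u' where "subsolution \<Omega> m G u'" "\<And>x j. j \<noteq> i \<Longrightarrow> u' x j = u x j"
    "\<And>x. x \<in> \<Omega> \<Longrightarrow> u x i \<le> u' x i" "\<And>x. x \<in> \<Omega> \<Longrightarrow> u' x i \<le> max (u x i) (z x)"
    "\<exists>x\<in>\<Omega>. u x i < u' x i"
proof -
  define r where "r = lsc_env_vec m \<Omega> u x0"
  have r: "r \<in> Rvec m" and r_eq: "\<And>j. j < m \<Longrightarrow> r j = lsc_env \<Omega> (\<lambda>y. u y j) x0"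
    by (simp_all add: r_def env_vec_in_Rvec) (simp add: lsc_env_vec_def)
  \<comment> \<open>This is \<phi> minus the quartic, written so that the perturbation lemma, which
    adds the quartic, can be applied to - \<phi>.\<close>
  define \<psi> where "\<psi> y = - (- \<phi> y + ((y - x0) \<bullet> (y - x0))\<^sup>2)" for y
  obtain D\<psi> D2\<psi> where C2\<psi>: "C2_with_derivs \<Omega> \<psi> D\<psi> D2\<psi>"
    and eq: "D\<psi> x0 = D\<phi> x0" "D2\<psi> x0 = D2\<phi> x0"
  proof -
    obtain D D2 where D: "C2_with_derivs \<Omega> (\<lambda>y. - \<phi> y + ((y - x0) \<bullet> (y - x0))\<^sup>2) D D2"
      "D x0 = - D\<phi> x0" "D2 x0 = - D2\<phi> x0"
      using C2_perturb_quartic[OF C2_minus[OF C2], of x0] by blast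
    show ?thesis
      using that[of "\<lambda>y. - D y" "\<lambda>y. - D2 y"] C2_minus[OF D(1)] D(2,3)
      unfolding \<psi>_def[abs_def] by simp
  qed
  have symm: "D2\<psi> y \<in> sym_matrices" if "y \<in> \<Omega>" for y
    using C2_hessian_symmetric[OF C2\<psi> open_domain that] .
  obtain N where N: "open N" "x0 \<in> N" "\<And>y. y \<in> N \<inter> \<Omega> \<Longrightarrow> \<phi> y \<le> lsc_env \<Omega> (\<lambda>y. u y i) y"
    and x0_eq: "\<phi> x0 = lsc_env \<Omega> (\<lambda>y. u y i) x0"
    using touch unfolding touches_below_def by (metis DiffI less_imp_le order_refl singletonD)
  have \<psi>x0: "\<psi> x0 = r i" using r_eq[OF i] x0_eq by (simp add: \<psi>_def)
  have "- G i x0 r (D\<psi> x0) (D2\<psi> x0) > 0" using neg by (simp add: eq r_def)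
  from nearby[OF i x0 r symm[OF x0] this]
  obtain e where "e > 0" and e: "\<And>x' r' p' X'. x' \<in> \<Omega> \<Longrightarrow> r' \<in> Rvec m \<Longrightarrow> X' \<in> sym_matrices \<Longrightarrow>
      dist x' x0 < e \<Longrightarrow> (\<forall>j<m. \<bar>r' j - r j\<bar> < e) \<Longrightarrow> dist p' (D\<psi> x0) < e \<Longrightarrow> dist X' (D2\<psi> x0) < e \<Longrightarrow>
      \<bar>G i x' r' p' X' - G i x0 r (D\<psi> x0) (D2\<psi> x0)\<bar> < - G i x0 r (D\<psi> x0) (D2\<psi> x0)"
    by blast
  \<comment> \<open>Half the gap to the lower envelope of \<open>z\<close> at \<open>x0\<close>;
    near \<open>x0\<close> that envelope stays above \<open>\<psi> x0 + \<gamma>\<close>.\<close>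
  define \<gamma> where "\<gamma> = (lsc_env \<Omega> z x0 - \<psi> x0) / 2"
  have "\<gamma> > 0" using below by (simp add: \<gamma>_def \<psi>x0 r_eq[OF i])
  have "\<psi> x0 + \<gamma> < lsc_env \<Omega> z x0" using \<open>\<gamma> > 0\<close> by (simp add: \<gamma>_def field_simps)
  then have "\<forall>\<^sub>F y in nhds x0. y \<in> \<Omega> \<longrightarrow> \<psi> x0 + \<gamma> < lsc_env \<Omega> z y"
    by (intro lsc_env_greater_nearby zb x0)
  moreover have "\<forall>\<^sub>F y in nhds x0. y \<in> \<Omega> \<and> y \<in> N"
    using open_domain x0 N by (intro eventually_conj eventually_nhds_in_open)
  moreover have "\<forall>\<^sub>F y in nhds x0. \<forall>j\<in>{..<m}. y \<in> \<Omega> \<longrightarrow> r j - e < lsc_env \<Omega> (\<lambda>y. u y j) y"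
    using \<open>e > 0\<close> x0 by (intro eventually_ball_finite ballI lsc_env_greater_nearby ub) (auto simp: r_eq)
  moreover have "\<forall>\<^sub>F y in nhds x0. y \<in> \<Omega> \<longrightarrow> dist (\<psi> y) (\<psi> x0) < min (e / 2) (\<gamma> / 2)"
    "\<forall>\<^sub>F y in nhds x0. y \<in> \<Omega> \<longrightarrow> dist (D\<psi> y) (D\<psi> x0) < e"
    "\<forall>\<^sub>F y in nhds x0. y \<in> \<Omega> \<longrightarrow> dist (D2\<psi> y) (D2\<psi> x0) < e"
    using C2_continuous_on[OF C2\<psi>] x0 \<open>e > 0\<close> \<open>\<gamma> > 0\<close> by - (rule continuous_on_nearby; simp)+
  moreover have "\<forall>\<^sub>F y in nhds x0. dist y x0 < e"
    using \<open>e > 0\<close> unfolding eventually_nhds_metric by blast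
  ultimately have "\<forall>\<^sub>F y in nhds x0. y \<in> \<Omega> \<and> y \<in> N \<and> \<psi> x0 + \<gamma> < lsc_env \<Omega> z y \<and>
      (\<forall>j<m. r j - e < lsc_env \<Omega> (\<lambda>y. u y j) y) \<and> dist (\<psi> y) (\<psi> x0) < min (e / 2) (\<gamma> / 2) \<and>
      dist (D\<psi> y) (D\<psi> x0) < e \<and> dist (D2\<psi> y) (D2\<psi> x0) < e \<and> dist y x0 < e"
    by eventually_elim auto
  then obtain d where "d > 0" and d: "\<And>y. dist y x0 < d \<Longrightarrow> y \<in> \<Omega> \<and> y \<in> N \<and> \<psi> x0 + \<gamma> < lsc_env \<Omega> z y \<and>
      (\<forall>j<m. r j - e < lsc_env \<Omega> (\<lambda>y. u y j) y) \<and> dist (\<psi> y) (\<psi> x0) < min (e / 2) (\<gamma> / 2) \<and>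
      dist (D\<psi> y) (D\<psi> x0) < e \<and> dist (D2\<psi> y) (D2\<psi> x0) < e \<and> dist y x0 < e"
    unfolding eventually_nhds_metric by blast
  \<comment> \<open>The three bounds keep component \<open>i\<close> within \<open>e\<close> of
    \<open>r i\<close>, keep the bump below \<open>z\<close>, and make it ineffective at distance at
    least \<open>d / 2\<close> from \<open>x0\<close>, where the quartic exceeds \<delta>.\<close>
  define \<delta> where "\<delta> = min (e / 2) (min (\<gamma> / 2) ((d / 2) ^ 4))"
  have "\<delta> > 0" and \<delta>_le: "\<delta> \<le> e / 2" "\<delta> \<le> \<gamma> / 2" "\<delta> \<le> (d / 2) ^ 4"
    using \<open>e > 0\<close> \<open>\<gamma> > 0\<close> \<open>d > 0\<close> by (auto simp: \<delta>_def)
  have \<psi>_near: "\<bar>\<psi> y - \<psi> x0\<bar> < e / 2" "\<bar>\<psi> y - \<psi> x0\<bar> < \<gamma> / 2" if "dist y x0 < d" for y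
    using d[OF that] by (auto simp: dist_real_def)
  define u' where "u' y j = (if j = i \<and> dist y x0 < d then max (u y j) (\<psi> y + \<delta>) else u y j)" for y j
  have other: "u' x j = u x j" if "j \<noteq> i" for x j using that by (simp add: u'_def)
  have u_le: "u x j \<le> u' x j" for x j by (simp add: u'_def)
  have \<psi>_z: "\<psi> y + \<delta> \<le> z y" if "dist y x0 < d" for y
    using \<psi>_near(2)[OF that] d[OF that] lsc_env_le[OF zb, of y] \<delta>_le(2) by linarith
  have u'_le: "u' x i \<le> max (u x i) (z x)" if "x \<in> \<Omega>" for x
    using \<psi>_z[of x] by (auto simp: u'_def)
  have u'b: "bounded ((\<lambda>x. u' x j) ` \<Omega>)" if j: "j < m" for j
  proof (cases "j = i")
    case True
    obtain B where B: "\<And>x. x \<in> \<Omega> \<Longrightarrow> \<bar>u x i\<bar> \<le> B" using bounded_image_realD[OF ub[OF i]] by blast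
    obtain C where C: "\<And>x. x \<in> \<Omega> \<Longrightarrow> \<bar>z x\<bar> \<le> C" using bounded_image_realD[OF zb] by blast
    have "\<bar>u' x i\<bar> \<le> max B C" if "x \<in> \<Omega>" for x
      using B[OF that] C[OF that] u'_le[OF that] u_le[of x i] by linarith
    then show ?thesis unfolding True bounded_iff by auto
  next
    case False
    then show ?thesis using ub[OF j] by (simp add: other)
  qed
  have usc_mono: "usc_env \<Omega> (\<lambda>y. u y j) x \<le> usc_env \<Omega> (\<lambda>y. u' y j) x" if "x \<in> \<Omega>" "j < m" for x j
    using that u_le by (intro usc_env_mono ub u'b)
  have usc_other: "usc_env \<Omega> (\<lambda>y. u' y j) = usc_env \<Omega> (\<lambda>y. u y j)" if "j \<noteq> i" for j
    using other[OF that] by simp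
  have outside: "u' y i = u y i" if y: "y \<in> \<Omega>" "d / 2 \<le> dist y x0" for y
  proof (cases "dist y x0 < d")
    case True
    have "\<phi> y \<le> lsc_env \<Omega> (\<lambda>y. u y i) y" using N(3)[of y] d[OF True] by blast
    also have "\<dots> \<le> u y i" by (rule lsc_env_le[OF ub[OF i] y(1)])
    also have "\<phi> y = \<psi> y + dist y x0 ^ 4" by (simp add: \<psi>_def quartic_eq_dist)
    finally have "\<psi> y + dist y x0 ^ 4 \<le> u y i" .
    moreover have "(d / 2) ^ 4 \<le> dist y x0 ^ 4" using y \<open>d > 0\<close> by (intro power_mono) auto
    ultimately have "\<psi> y + \<delta> \<le> u y i" using \<delta>_le(3) by linarith
    then show ?thesis by (simp add: u'_def)
  qed (simp add: u'_def)
  \<comment> \<open>Inside the ball, continuity of \<psi> bounds the envelope of the maximum by the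
    maximum of the envelopes. At distance at least \<open>d\<close> from \<open>x0\<close>, all
    points within \<open>d / 2\<close> lie where \<open>u'\<close> and \<open>u\<close>
    agree.\<close>
  have usc_cases: "usc_env \<Omega> (\<lambda>y. u' y i) x \<le> usc_env \<Omega> (\<lambda>y. u y i) x \<or>
      dist x x0 < d \<and> usc_env \<Omega> (\<lambda>y. u' y i) x \<le> \<psi> x + \<delta>" if x: "x \<in> \<Omega>" for x
  proof (cases "dist x x0 < d")
    case True
    have "usc_env \<Omega> (\<lambda>y. u' y i) x \<le> max (usc_env \<Omega> (\<lambda>y. u y i) x) (\<psi> x + \<delta>)"
    proof (rule dense_ge)
      fix c assume c: "max (usc_env \<Omega> (\<lambda>y. u y i) x) (\<psi> x + \<delta>) < c"
      then obtain d1 where d1: "d1 > 0" "\<And>y. y \<in> \<Omega> \<Longrightarrow> dist y x < d1 \<Longrightarrow> u y i < c"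
        using usc_env_lessD[OF ub[OF i] x, of c] by auto
      have "c - (\<psi> x + \<delta>) > 0" using c by simp
      then obtain d2 where d2: "d2 > 0" "\<And>y. y \<in> \<Omega> \<Longrightarrow> dist y x < d2 \<Longrightarrow> dist (\<psi> y) (\<psi> x) < c - (\<psi> x + \<delta>)"
        using C2_continuous_on(1)[OF C2\<psi>] x unfolding continuous_on_iff by metis
      show "usc_env \<Omega> (\<lambda>y. u' y i) x \<le> c"
      proof (rule usc_env_leI[OF u'b[OF i] x, of "min d1 d2"])
        fix y assume y: "y \<in> \<Omega>" "dist y x < min d1 d2"
        then have "u y i < c" "\<psi> y + \<delta> < c"
          using d1(2)[of y] d2(2)[of y] by (auto simp: dist_real_def)
        then show "u' y i \<le> c" by (simp add: u'_def)
      qed (use d1 d2 in simp)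
    qed
    with True show ?thesis by (auto simp: le_max_iff_disj)
  next
    case False
    have "usc_env \<Omega> (\<lambda>y. u' y i) x \<le> usc_env \<Omega> (\<lambda>y. u y i) x"
    proof (rule dense_ge)
      fix c assume "usc_env \<Omega> (\<lambda>y. u y i) x < c"
      then obtain d1 where d1: "d1 > 0" "\<And>y. y \<in> \<Omega> \<Longrightarrow> dist y x < d1 \<Longrightarrow> u y i < c"
        using usc_env_lessD[OF ub[OF i] x, of c] by auto
      show "usc_env \<Omega> (\<lambda>y. u' y i) x \<le> c"
      proof (rule usc_env_leI[OF u'b[OF i] x, of "min d1 (d / 2)"])
        fix y assume y: "y \<in> \<Omega>" "dist y x < min d1 (d / 2)"
        then have "d / 2 \<le> dist y x0"
          using False dist_triangle[of x x0 y] by (simp add: dist_commute)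
        then show "u' y i \<le> c" using outside[OF y(1)] d1(2)[OF y(1)] y(2) by simp
      qed (use d1 \<open>d > 0\<close> in simp)
    qed
    then show ?thesis ..
  qed
  have sub': "subsolution \<Omega> m G u'"
    unfolding subsolution_def
  proof (intro ballI allI impI; elim conjE)
    fix x k \<zeta> D\<zeta> D2\<zeta>
    assume x: "x \<in> \<Omega>" and k: "k < m" and C2\<zeta>: "C2_with_derivs \<Omega> \<zeta> D\<zeta> D2\<zeta>"
      and touch\<zeta>: "touches_above \<Omega> \<zeta> (usc_env \<Omega> (\<lambda>y. u' y k)) x"
    note sym\<zeta> = C2_hessian_symmetric[OF C2\<zeta> open_domain x]
    show "G k x (usc_env_vec m \<Omega> u' x) (D\<zeta> x) (D2\<zeta> x) \<le> 0"
    \<comment> \<open>If the envelope has not risen at \<open>x\<close>, the test function also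
      touches the old one. If it has, then \<open>k = i\<close> and the new value at
      \<open>x\<close> is exactly \<open>\<psi> x + \<delta>\<close>.\<close>
    proof (cases "usc_env \<Omega> (\<lambda>y. u' y k) x \<le> usc_env \<Omega> (\<lambda>y. u y k) x")
      case True
      then have eq_k: "usc_env \<Omega> (\<lambda>y. u' y k) x = usc_env \<Omega> (\<lambda>y. u y k) x"
        using usc_mono[OF x k] by simp
      have "touches_above \<Omega> \<zeta> (usc_env \<Omega> (\<lambda>y. u y k)) x"
        using touch\<zeta> usc_mono[OF _ k] unfolding touches_above_def eq_k
        by (meson DiffD1 IntD2 le_less_trans)
      then have "G k x (usc_env_vec m \<Omega> u x) (D\<zeta> x) (D2\<zeta> x) \<le> 0"
        using sub x k C2\<zeta> unfolding subsolution_def by blast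
      moreover have "G k x (usc_env_vec m \<Omega> u' x) (D\<zeta> x) (D2\<zeta> x) \<le> G k x (usc_env_vec m \<Omega> u x) (D\<zeta> x) (D2\<zeta> x)"
        using usc_mono[OF x] k eq_k
        by (intro quasi_monotone[OF k x env_vec_in_Rvec(1) env_vec_in_Rvec(1) sym\<zeta>])
           (auto simp: vec_le_def usc_env_vec_def)
      ultimately show ?thesis by linarith
    next
      case False
      then have ki: "k = i" using usc_other by force
      have dx: "dist x x0 < d" and le\<psi>: "usc_env \<Omega> (\<lambda>y. u' y i) x \<le> \<psi> x + \<delta>"
        using usc_cases[OF x] False ki by auto
      have ge\<psi>: "\<psi> y + \<delta> \<le> usc_env \<Omega> (\<lambda>y. u' y i) y" if "dist y x0 < d" for y
      proof -
        have "\<psi> y + \<delta> \<le> u' y i" using that by (simp add: u'_def)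
        also have "\<dots> \<le> usc_env \<Omega> (\<lambda>y. u' y i) y" using d[OF that] by (intro le_usc_env[OF u'b[OF i]]) simp
        finally show ?thesis .
      qed
      have eq\<psi>: "usc_env \<Omega> (\<lambda>y. u' y i) x = \<psi> x + \<delta>" using le\<psi> ge\<psi>[OF dx] by simp
      obtain M where M: "open M" "x \<in> M" "\<And>y. y \<in> M \<inter> \<Omega> \<Longrightarrow> usc_env \<Omega> (\<lambda>y. u' y i) y \<le> \<zeta> y"
        and \<zeta>x: "\<zeta> x = usc_env \<Omega> (\<lambda>y. u' y i) x"
        using touch\<zeta> unfolding touches_above_def ki by (metis DiffI less_imp_le order_refl singletonD)
      \<comment> \<open>Near \<open>x\<close> the function \<psi> + \<delta> lies below the new
        envelope and meets it at \<open>x\<close>, so \<zeta> - \<psi> has a local minimum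
        there.\<close>
      have "\<psi> y - \<psi> x \<le> \<zeta> y - \<zeta> x" if "y \<in> M \<inter> ball x0 d \<inter> \<Omega>" for y
        using that M(3)[of y] ge\<psi>[of y] by (auto simp: \<zeta>x eq\<psi> dist_commute)
      then have D: "D\<zeta> x = D\<psi> x" and D2: "matrix_le (D2\<psi> x) (D2\<zeta> x)"
        using C2_local_min[OF C2\<psi> C2\<zeta> open_domain x, of "M \<inter> ball x0 d"] M dx
        by (auto simp: dist_commute)
      \<comment> \<open>Now the vector must lie below the new envelope, hence the minimum. It stays
        above \<open>r j - e\<close> because the lower envelope of \<open>u\<close> at
        \<open>x\<close> does and is dominated by the upper one.\<close>
      define r' where "r' = (\<lambda>j\<in>{..<m}. if j = i then \<psi> x + \<delta> else min (usc_env \<Omega> (\<lambda>y. u y j) x) (r j))"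
      have r': "r' \<in> Rvec m" by (simp add: r'_def Rvec_def)
      have "\<bar>r' j - r j\<bar> < e" if j: "j < m" for j
      proof (cases "j = i")
        case True
        have "\<bar>\<psi> x + \<delta> - \<psi> x0\<bar> < e" using \<psi>_near(1)[OF dx] \<delta>_le(1) \<open>\<delta> > 0\<close> by linarith
        then show ?thesis using True i by (simp add: r'_def \<psi>x0)
      next
        case False
        have "r j - e < lsc_env \<Omega> (\<lambda>y. u y j) x" using d[OF dx] j by blast
        also have "\<dots> \<le> u x j" by (rule lsc_env_le[OF ub[OF j] x])
        also have "\<dots> \<le> usc_env \<Omega> (\<lambda>y. u y j) x" by (rule le_usc_env[OF ub[OF j] x])
        finally have "r j - e < min (usc_env \<Omega> (\<lambda>y. u y j) x) (r j)" using \<open>e > 0\<close> by simp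
        moreover have "min (usc_env \<Omega> (\<lambda>y. u y j) x) (r j) \<le> r j" by simp
        moreover have "r' j = min (usc_env \<Omega> (\<lambda>y. u y j) x) (r j)" using False j by (simp add: r'_def)
        ultimately show ?thesis using \<open>e > 0\<close> by linarith
      qed
      then have "\<bar>G i x r' (D\<psi> x) (D2\<psi> x) - G i x0 r (D\<psi> x0) (D2\<psi> x0)\<bar> < - G i x0 r (D\<psi> x0) (D2\<psi> x0)"
        using d[OF dx] x symm r' by (intro e) auto
      moreover have "G i x (usc_env_vec m \<Omega> u' x) (D\<psi> x) (D2\<psi> x) \<le> G i x r' (D\<psi> x) (D2\<psi> x)"
        using i by (intro quasi_monotone[OF i x r' env_vec_in_Rvec(1) symm[OF x]])
          (auto simp: vec_le_def usc_env_vec_def r'_def eq\<psi> usc_other)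
      moreover have "G i x (usc_env_vec m \<Omega> u' x) (D\<psi> x) (D2\<zeta> x) \<le> G i x (usc_env_vec m \<Omega> u' x) (D\<psi> x) (D2\<psi> x)"
        by (rule elliptic[OF i x env_vec_in_Rvec(1) symm[OF x] sym\<zeta> D2])
      ultimately show ?thesis unfolding ki D by linarith
    qed
  qed
  have "\<exists>x\<in>\<Omega>. u x i < u' x i"
  proof (rule ccontr)
    assume "\<not> ?thesis"
    \<comment> \<open>Without a real increase, \<open>\<psi> + \<delta>\<close> would be below
      \<open>u\<close> in component \<open>i\<close> on the whole ball, and the lower envelope at
      \<open>x0\<close> would exceed its contact value \<open>\<psi> x0\<close>.\<close>
    then have ge: "\<psi> y + \<delta> \<le> u y i" if "dist y x0 < d" for y
      using d[OF that] that by (force simp: u'_def)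
    obtain d1 where d1: "d1 > 0" "\<And>y. y \<in> \<Omega> \<Longrightarrow> dist y x0 < d1 \<Longrightarrow> dist (\<psi> y) (\<psi> x0) < \<delta> / 2"
      using C2_continuous_on(1)[OF C2\<psi>] x0 \<open>\<delta> > 0\<close> unfolding continuous_on_iff by (meson half_gt_zero)
    have "\<psi> x0 + \<delta> / 2 \<le> lsc_env \<Omega> (\<lambda>y. u y i) x0"
    proof (rule lsc_env_geI[OF ub[OF i] x0, of "min d d1"])
      fix y assume y: "y \<in> \<Omega>" "dist y x0 < min d d1"
      then have "\<bar>\<psi> y - \<psi> x0\<bar> < \<delta> / 2" "\<psi> y + \<delta> \<le> u y i"
        using d1(2)[of y] ge[of y] by (auto simp: dist_real_def)
      then show "\<psi> x0 + \<delta> / 2 \<le> u y i" by linarith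
    qed (use \<open>d > 0\<close> d1 in simp)
    then show False using \<psi>x0 r_eq[OF i] \<open>\<delta> > 0\<close> by simp
  qed
  with sub' other u_le u'_le show ?thesis using that by blast
qed

theorem perron:
  assumes w: "subsolution \<Omega> m G w" and z: "supersolution \<Omega> m G z"
    and wb: "\<And>i. i < m \<Longrightarrow> bounded ((\<lambda>x. w x i) ` \<Omega>)"
    and zb: "\<And>i. i < m \<Longrightarrow> bounded ((\<lambda>x. z x i) ` \<Omega>)"
    and wz: "\<And>x i. x \<in> \<Omega> \<Longrightarrow> i < m \<Longrightarrow> w x i \<le> z x i"
  obtains u where "subsolution \<Omega> m G u" "supersolution \<Omega> m G u"
    "\<And>x i. x \<in> \<Omega> \<Longrightarrow> i < m \<Longrightarrow> w x i \<le> u x i \<and> u x i \<le> z x i"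
proof -
  define S where "S = {v. subsolution \<Omega> m G v \<and> (\<forall>x\<in>\<Omega>. \<forall>i<m. w x i \<le> v x i \<and> v x i \<le> z x i)}"
  define u where "u x i = (SUP v\<in>S. v x i)" for x i
  have "w \<in> S" using w wz by (simp add: S_def)
  have bdd: "bdd_above ((\<lambda>v. v x i) ` S)" if "x \<in> \<Omega>" "i < m" for x i
    using that by (auto simp: S_def bdd_above_def)
  have le: "v x i \<le> u x i" if "v \<in> S" "x \<in> \<Omega>" "i < m" for v x i
    unfolding u_def using that bdd by (intro cSUP_upper)
  have uz: "u x i \<le> z x i" if "x \<in> \<Omega>" "i < m" for x i
    unfolding u_def using that \<open>w \<in> S\<close> by (intro cSUP_least) (auto simp: S_def)
  have wu: "w x i \<le> u x i" if "x \<in> \<Omega>" "i < m" for x i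
    using le[OF \<open>w \<in> S\<close> that] .
  \<comment> \<open>The bound precedes the quantifier over \<open>v\<close>: it is uniform over the
    family, as the supremum lemma requires.\<close>
  have between: "\<exists>B. \<forall>v. (\<forall>x\<in>\<Omega>. w x i \<le> v x i \<and> v x i \<le> z x i) \<longrightarrow> (\<forall>x\<in>\<Omega>. \<bar>v x i\<bar> \<le> B)"
    if i: "i < m" for i
  proof -
    obtain B where B: "\<And>x. x \<in> \<Omega> \<Longrightarrow> \<bar>w x i\<bar> \<le> B" using bounded_image_realD[OF wb[OF i]] by blast
    obtain C where C: "\<And>x. x \<in> \<Omega> \<Longrightarrow> \<bar>z x i\<bar> \<le> C" using bounded_image_realD[OF zb[OF i]] by blast
    have "\<bar>v x i\<bar> \<le> max B C" if "x \<in> \<Omega>" "w x i \<le> v x i \<and> v x i \<le> z x i" for v :: "real^'n \<Rightarrow> nat \<Rightarrow> real" and x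
      using B[OF that(1)] C[OF that(1)] that(2) by linarith
    then show ?thesis by blast
  qed
  have ub: "bounded ((\<lambda>x. u x i) ` \<Omega>)" if "i < m" for i
    using wu[OF _ that] uz[OF _ that] by (intro bounded_image_between[OF wb[OF that] zb[OF that]]) simp
  have sub: "subsolution \<Omega> m G u"
  proof (rule subsolution_Sup[of S])
    show "\<exists>B. \<forall>v\<in>S. \<forall>x\<in>\<Omega>. \<bar>v x i\<bar> \<le> B" if "i < m" for i
      using between[OF that] that unfolding S_def by blast
  qed (use \<open>w \<in> S\<close> in \<open>auto simp: S_def u_def\<close>)
  have "supersolution \<Omega> m G u"
    unfolding supersolution_def
  proof (intro ballI allI impI; elim conjE; rule ccontr)
    fix x i \<phi> D\<phi> D2\<phi>
    assume x: "x \<in> \<Omega>" and i: "i < m" and C2: "C2_with_derivs \<Omega> \<phi> D\<phi> D2\<phi>"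
      and touch: "touches_below \<Omega> \<phi> (lsc_env \<Omega> (\<lambda>y. u y i)) x"
      and "\<not> 0 \<le> G i x (lsc_env_vec m \<Omega> u x) (D\<phi> x) (D2\<phi> x)"
    then have neg: "G i x (lsc_env_vec m \<Omega> u x) (D\<phi> x) (D2\<phi> x) < 0" by simp
    have mono: "lsc_env \<Omega> (\<lambda>y. u y j) y \<le> lsc_env \<Omega> (\<lambda>y. z y j) y" if "y \<in> \<Omega>" "j < m" for y j
      using that uz by (intro lsc_env_mono ub zb)
    \<comment> \<open>In case of equality \<phi> would also touch the lower envelope of
      \<open>z\<close>. The supersolution inequality for \<open>z\<close>, whose envelopes are the
      larger ones with equal component \<open>i\<close>, would then pass down to
      \<open>u\<close>.\<close>
    have "lsc_env \<Omega> (\<lambda>y. u y i) x < lsc_env \<Omega> (\<lambda>y. z y i) x"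
    proof (rule ccontr)
      assume "\<not> ?thesis"
      then have eq: "lsc_env \<Omega> (\<lambda>y. u y i) x = lsc_env \<Omega> (\<lambda>y. z y i) x"
        using mono[OF x i] by simp
      have "touches_below \<Omega> \<phi> (lsc_env \<Omega> (\<lambda>y. z y i)) x"
        using touch mono[OF _ i] unfolding touches_below_def eq
        by (meson DiffD1 IntD2 less_le_trans)
      then have "0 \<le> G i x (lsc_env_vec m \<Omega> z x) (D\<phi> x) (D2\<phi> x)"
        using z x i C2 unfolding supersolution_def by blast
      also have "\<dots> \<le> G i x (lsc_env_vec m \<Omega> u x) (D\<phi> x) (D2\<phi> x)"
        using mono[OF x] i eq
        by (intro quasi_monotone[OF i x env_vec_in_Rvec(2) env_vec_in_Rvec(2) C2_hessian_symmetric[OF C2 open_domain x]])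
           (auto simp: vec_le_def lsc_env_vec_def)
      finally show False using neg by simp
    qed
    from subsolution_bump[OF sub ub zb[OF i] x i C2 touch neg this]
    obtain u' where u': "subsolution \<Omega> m G u'" "\<And>x j. j \<noteq> i \<Longrightarrow> u' x j = u x j"
      "\<And>x. x \<in> \<Omega> \<Longrightarrow> u x i \<le> u' x i" "\<And>x. x \<in> \<Omega> \<Longrightarrow> u' x i \<le> max (u x i) (z x i)"
      "\<exists>x\<in>\<Omega>. u x i < u' x i" by blast
    have "w x j \<le> u' x j \<and> u' x j \<le> z x j" if "x \<in> \<Omega>" "j < m" for x j
      using wu[OF that] uz[OF that] u'(2)[of j x] u'(3,4)[OF that(1)] by (cases "j = i") auto
    then have "u' \<in> S" using u'(1) by (simp add: S_def)
    then show False using le i u'(5) by (meson not_less)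
  qed
  with sub wu uz show ?thesis using that by blast
qed

end

section \<open>Reduction to a quasi-monotone system\<close>

text \<open>
  The second group enters with the opposite sign: \<open>flip_system m1 m2 F\<close> is the system satisfied by
  \<open>(u\<^sub>1, - u\<^sub>2)\<close>, and super-sub solutions of \<open>F\<close> become its supersolutions.
\<close>

definition flip_system ::
  "nat \<Rightarrow> nat \<Rightarrow> (nat \<Rightarrow> real^'n \<Rightarrow> (nat \<Rightarrow> real) \<Rightarrow> (nat \<Rightarrow> real) \<Rightarrow> real^'n \<Rightarrow> real^'n^'n \<Rightarrow> real) \<Rightarrow>
    nat \<Rightarrow> real^'n \<Rightarrow> (nat \<Rightarrow> real) \<Rightarrow> real^'n \<Rightarrow> real^'n^'n \<Rightarrow> real" where
  "flip_system m1 m2 F i x r p X =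
     (if i < m1 then F i x (restrict r {..<m1}) (\<lambda>j\<in>{..<m2}. - r (m1 + j)) p X
      else - F i x (restrict r {..<m1}) (\<lambda>j\<in>{..<m2}. - r (m1 + j)) (- p) (- X))"

definition flip_join :: "nat \<Rightarrow> (real^'n \<Rightarrow> nat \<Rightarrow> real) \<Rightarrow> (real^'n \<Rightarrow> nat \<Rightarrow> real) \<Rightarrow> real^'n \<Rightarrow> nat \<Rightarrow> real" where
  "flip_join m1 u1 u2 x i = (if i < m1 then u1 x i else - u2 x (i - m1))"

lemma flip_join_apply:
  "i < m1 \<Longrightarrow> flip_join m1 u1 u2 x i = u1 x i"
  "flip_join m1 u1 u2 x (m1 + j) = - u2 x j"
  by (simp_all add: flip_join_def)

lemma touches_below_minus_iff:
  "touches_below \<Omega> \<phi> (\<lambda>x. - f x) x \<longleftrightarrow> touches_above \<Omega> (\<lambda>x. - \<phi> x) f x"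
  unfolding touches_below_def touches_above_def by (auto simp: less_minus_iff minus_equation_iff)

lemma touches_above_minus_iff:
  "touches_above \<Omega> \<phi> (\<lambda>x. - f x) x \<longleftrightarrow> touches_below \<Omega> (\<lambda>x. - \<phi> x) f x"
  unfolding touches_below_def touches_above_def by (auto simp: minus_less_iff minus_equation_iff)

lemma env_minus:
  "lsc_env \<Omega> (\<lambda>y. - f y) = (\<lambda>x. - usc_env \<Omega> f x)" "usc_env \<Omega> (\<lambda>y. - f y) = (\<lambda>x. - lsc_env \<Omega> f x)"
  by (simp_all add: lsc_env_eq_usc_env fun_eq_iff)

text \<open>Negation exchanges the two envelopes, so one kind of envelope of the joined function
  encodes precisely the mixed pair of envelopes in the definition of super-sub or sub-super
  solutions.\<close>

lemma flip_join_env_vec: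
  "restrict (lsc_env_vec (m1 + m2) \<Omega> (flip_join m1 u1 u2) x) {..<m1} = lsc_env_vec m1 \<Omega> u1 x"
  "(\<lambda>j\<in>{..<m2}. - lsc_env_vec (m1 + m2) \<Omega> (flip_join m1 u1 u2) x (m1 + j)) = usc_env_vec m2 \<Omega> u2 x"
  "restrict (usc_env_vec (m1 + m2) \<Omega> (flip_join m1 u1 u2) x) {..<m1} = usc_env_vec m1 \<Omega> u1 x"
  "(\<lambda>j\<in>{..<m2}. - usc_env_vec (m1 + m2) \<Omega> (flip_join m1 u1 u2) x (m1 + j)) = lsc_env_vec m2 \<Omega> u2 x"
  by (auto simp: lsc_env_vec_def usc_env_vec_def flip_join_apply env_minus fun_eq_iff)

lemma less_add_cases:
  fixes i m1 m2 :: nat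
  assumes "i < m1 + m2"
  obtains "i < m1" | j where "i = m1 + j" "j < m2"
  using assms by (metis add_less_cancel_left le_Suc_ex not_le_imp_less)

text \<open>An equivalence, since the given barrier is carried to the transformed system and the
  solution found there is carried back. In the second group the test function is - \<phi>, whose
  derivatives undo the signs inside \<open>flip_system\<close>.\<close>

lemma flip_join_super:
  "super_sub_solution \<Omega> m1 m2 F u1 u2 \<longleftrightarrow>
     bounded_vector_fun \<Omega> m1 u1 \<and> bounded_vector_fun \<Omega> m2 u2 \<and>
     supersolution \<Omega> (m1 + m2) (flip_system m1 m2 F) (flip_join m1 u1 u2)" (is "?L \<longleftrightarrow> ?B1 \<and> ?B2 \<and> ?R")
proof -
  let ?u = "flip_join m1 u1 u2"
  have ?R if L: ?L
    unfolding supersolution_def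
  proof (intro ballI allI impI; elim conjE)
    fix x i \<phi> D\<phi> D2\<phi>
    assume x: "x \<in> \<Omega>" and "i < m1 + m2" and C2: "C2_with_derivs \<Omega> \<phi> D\<phi> D2\<phi>"
      and touch: "touches_below \<Omega> \<phi> (lsc_env \<Omega> (\<lambda>y. ?u y i)) x"
    from \<open>i < m1 + m2\<close> show "0 \<le> flip_system m1 m2 F i x (lsc_env_vec (m1 + m2) \<Omega> ?u x) (D\<phi> x) (D2\<phi> x)"
    proof (cases rule: less_add_cases)
      case 1
      then show ?thesis
        using L x C2 touch unfolding super_sub_solution_def flip_system_def
        by (simp add: flip_join_env_vec flip_join_apply)
    next
      case (2 j)
      have "F (m1 + j) x (lsc_env_vec m1 \<Omega> u1 x) (usc_env_vec m2 \<Omega> u2 x) (- D\<phi> x) (- D2\<phi> x) \<le> 0"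
      proof -
        have "touches_above \<Omega> (\<lambda>y. - \<phi> y) (usc_env \<Omega> (\<lambda>y. u2 y j)) x"
          using touch by (simp add: 2(1) flip_join_apply env_minus touches_below_minus_iff)
        moreover have "F (m1 + j) x (lsc_env_vec m1 \<Omega> u1 x) (usc_env_vec m2 \<Omega> u2 x) (D\<psi> x) (D2\<psi> x) \<le> 0"
          if "C2_with_derivs \<Omega> \<psi> D\<psi> D2\<psi>" "touches_above \<Omega> \<psi> (usc_env \<Omega> (\<lambda>y. u2 y j)) x" for \<psi> D\<psi> D2\<psi>
          using L x 2(2) that unfolding super_sub_solution_def by blast
        ultimately show ?thesis using C2_minus[OF C2] by blast
      qed
      then show ?thesis using 2 by (simp add: flip_system_def flip_join_env_vec)
    qed
  qed
  moreover have ?L if bd: ?B1 ?B2 and R: ?R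
    unfolding super_sub_solution_def
  proof (intro conjI bd ballI allI impI; elim conjE)
    fix x j \<phi> D\<phi> D2\<phi>
    assume x: "x \<in> \<Omega>" and j: "j < m1" and C2: "C2_with_derivs \<Omega> \<phi> D\<phi> D2\<phi>"
      and touch: "touches_below \<Omega> \<phi> (lsc_env \<Omega> (\<lambda>y. u1 y j)) x"
    then have "0 \<le> flip_system m1 m2 F j x (lsc_env_vec (m1 + m2) \<Omega> ?u x) (D\<phi> x) (D2\<phi> x)"
      using R unfolding supersolution_def by (simp add: flip_join_apply)
    then show "0 \<le> F j x (lsc_env_vec m1 \<Omega> u1 x) (usc_env_vec m2 \<Omega> u2 x) (D\<phi> x) (D2\<phi> x)"
      using j by (simp add: flip_system_def flip_join_env_vec)
  next
    fix x j \<phi> D\<phi> D2\<phi>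
    assume x: "x \<in> \<Omega>" and j: "j < m2" and C2: "C2_with_derivs \<Omega> \<phi> D\<phi> D2\<phi>"
      and touch: "touches_above \<Omega> \<phi> (usc_env \<Omega> (\<lambda>y. u2 y j)) x"
    have "touches_below \<Omega> (\<lambda>y. - \<phi> y) (lsc_env \<Omega> (\<lambda>y. ?u y (m1 + j))) x"
      using touch by (simp add: flip_join_apply env_minus touches_below_minus_iff)
    then have "0 \<le> flip_system m1 m2 F (m1 + j) x (lsc_env_vec (m1 + m2) \<Omega> ?u x) (- D\<phi> x) (- D2\<phi> x)"
      using R x j C2_minus[OF C2] unfolding supersolution_def by (metis add_less_cancel_left)
    then show "F (m1 + j) x (lsc_env_vec m1 \<Omega> u1 x) (usc_env_vec m2 \<Omega> u2 x) (D\<phi> x) (D2\<phi> x) \<le> 0"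
      by (simp add: flip_system_def flip_join_env_vec)
  qed
  ultimately show ?thesis unfolding super_sub_solution_def by blast
qed

lemma flip_join_sub:
  "sub_super_solution \<Omega> m1 m2 F u1 u2 \<longleftrightarrow>
     bounded_vector_fun \<Omega> m1 u1 \<and> bounded_vector_fun \<Omega> m2 u2 \<and>
     subsolution \<Omega> (m1 + m2) (flip_system m1 m2 F) (flip_join m1 u1 u2)" (is "?L \<longleftrightarrow> ?B1 \<and> ?B2 \<and> ?R")
proof -
  let ?u = "flip_join m1 u1 u2"
  have ?R if L: ?L
    unfolding subsolution_def
  proof (intro ballI allI impI; elim conjE)
    fix x i \<phi> D\<phi> D2\<phi>
    assume x: "x \<in> \<Omega>" and "i < m1 + m2" and C2: "C2_with_derivs \<Omega> \<phi> D\<phi> D2\<phi>"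
      and touch: "touches_above \<Omega> \<phi> (usc_env \<Omega> (\<lambda>y. ?u y i)) x"
    from \<open>i < m1 + m2\<close> show "flip_system m1 m2 F i x (usc_env_vec (m1 + m2) \<Omega> ?u x) (D\<phi> x) (D2\<phi> x) \<le> 0"
    proof (cases rule: less_add_cases)
      case 1
      then show ?thesis
        using L x C2 touch unfolding sub_super_solution_def flip_system_def
        by (simp add: flip_join_env_vec flip_join_apply)
    next
      case (2 j)
      have "F (m1 + j) x (usc_env_vec m1 \<Omega> u1 x) (lsc_env_vec m2 \<Omega> u2 x) (- D\<phi> x) (- D2\<phi> x) \<ge> 0"
      proof -
        have "touches_below \<Omega> (\<lambda>y. - \<phi> y) (lsc_env \<Omega> (\<lambda>y. u2 y j)) x"
          using touch by (simp add: 2(1) flip_join_apply env_minus touches_above_minus_iff)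
        moreover have "F (m1 + j) x (usc_env_vec m1 \<Omega> u1 x) (lsc_env_vec m2 \<Omega> u2 x) (D\<psi> x) (D2\<psi> x) \<ge> 0"
          if "C2_with_derivs \<Omega> \<psi> D\<psi> D2\<psi>" "touches_below \<Omega> \<psi> (lsc_env \<Omega> (\<lambda>y. u2 y j)) x" for \<psi> D\<psi> D2\<psi>
          using L x 2(2) that unfolding sub_super_solution_def by blast
        ultimately show ?thesis using C2_minus[OF C2] by blast
      qed
      then show ?thesis using 2 by (simp add: flip_system_def flip_join_env_vec)
    qed
  qed
  moreover have ?L if bd: ?B1 ?B2 and R: ?R
    unfolding sub_super_solution_def
  proof (intro conjI bd ballI allI impI; elim conjE)
    fix x j \<phi> D\<phi> D2\<phi>
    assume x: "x \<in> \<Omega>" and j: "j < m1" and C2: "C2_with_derivs \<Omega> \<phi> D\<phi> D2\<phi>"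
      and touch: "touches_above \<Omega> \<phi> (usc_env \<Omega> (\<lambda>y. u1 y j)) x"
    then have "flip_system m1 m2 F j x (usc_env_vec (m1 + m2) \<Omega> ?u x) (D\<phi> x) (D2\<phi> x) \<le> 0"
      using R unfolding subsolution_def by (simp add: flip_join_apply)
    then show "F j x (usc_env_vec m1 \<Omega> u1 x) (lsc_env_vec m2 \<Omega> u2 x) (D\<phi> x) (D2\<phi> x) \<le> 0"
      using j by (simp add: flip_system_def flip_join_env_vec)
  next
    fix x j \<phi> D\<phi> D2\<phi>
    assume x: "x \<in> \<Omega>" and j: "j < m2" and C2: "C2_with_derivs \<Omega> \<phi> D\<phi> D2\<phi>"
      and touch: "touches_below \<Omega> \<phi> (lsc_env \<Omega> (\<lambda>y. u2 y j)) x"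
    have "touches_above \<Omega> (\<lambda>y. - \<phi> y) (usc_env \<Omega> (\<lambda>y. ?u y (m1 + j))) x"
      using touch by (simp add: flip_join_apply env_minus touches_above_minus_iff)
    then have "flip_system m1 m2 F (m1 + j) x (usc_env_vec (m1 + m2) \<Omega> ?u x) (- D\<phi> x) (- D2\<phi> x) \<le> 0"
      using R x j C2_minus[OF C2] unfolding subsolution_def by (metis add_less_cancel_left)
    then show "0 \<le> F (m1 + j) x (usc_env_vec m1 \<Omega> u1 x) (lsc_env_vec m2 \<Omega> u2 x) (D\<phi> x) (D2\<phi> x)"
      by (simp add: flip_system_def flip_join_env_vec)
  qed
  ultimately show ?thesis unfolding sub_super_solution_def by blast
qed

lemma bounded_flip_join:
  assumes "bounded_vector_fun \<Omega> m1 u1" "bounded_vector_fun \<Omega> m2 u2" "i < m1 + m2"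
  shows "bounded ((\<lambda>x. flip_join m1 u1 u2 x i) ` \<Omega>)"
  using assms(3)
proof (cases rule: less_add_cases)
  case 1
  then show ?thesis using assms(1) by (simp add: flip_join_apply bounded_vector_fun_def)
next
  case (2 j)
  then show ?thesis
    using assms(2) by (simp add: flip_join_apply bounded_vector_fun_def bounded_uminus_image)
qed

lemma uminus_sym_matrices: "X \<in> sym_matrices \<Longrightarrow> - X \<in> sym_matrices"
  by (simp add: sym_matrices_def transpose_def vec_eq_iff)

lemma matrix_le_uminus: "matrix_le X Y \<Longrightarrow> matrix_le (- Y) (- X)"
  by (simp add: matrix_le_def uminus_matrix_vector_mult)

text \<open>Raising \<open>r\<close> raises the first block and lowers the second. Both moves lower
  a first-group equation and raise a second-group one, and the outer minus sign reverses the latter.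
  In the ellipticity condition the signs of the matrix and of the equation cancel.\<close>

lemma quasi_monotone_flip_system:
  fixes \<Omega> :: "(real^'n) set"
  assumes "open \<Omega>" and cont: "continuous_system \<Omega> m1 m2 F" and ell: "degenerate_elliptic \<Omega> m1 m2 F"
    and bqm: "balanced_quasi_monotone \<Omega> m1 m2 F"
  shows "quasi_monotone_system \<Omega> (m1 + m2) (flip_system m1 m2 F)"
proof
  let ?r1 = "\<lambda>r. restrict r {..<m1}" and ?r2 = "\<lambda>r. \<lambda>j\<in>{..<m2}. - r (m1 + j)"
  have in_Rvec: "?r1 r \<in> Rvec m1" "?r2 r \<in> Rvec m2" for r :: "nat \<Rightarrow> real"
    by (simp_all add: Rvec_def)
  show "open \<Omega>" by fact
  fix i assume i: "i < m1 + m2"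
  {
    let ?D = "\<Omega> \<times> Rvec (m1 + m2) \<times> UNIV \<times> sym_matrices"
    have F: "continuous_on (\<Omega> \<times> Rvec m1 \<times> Rvec m2 \<times> UNIV \<times> sym_matrices) (\<lambda>(x, r, s, p, X). F i x r s p X)"
      using cont i by (simp add: continuous_system_def)
    have coord: "continuous_on A (\<lambda>q :: (real^'n) \<times> (nat \<Rightarrow> real) \<times> (real^'n) \<times> (real^'n^'n). fst (snd q) j)" for A j
      by (rule continuous_on_product_then_coordinatewise) (intro continuous_intros)
    have r1: "continuous_on A (\<lambda>q :: (real^'n) \<times> (nat \<Rightarrow> real) \<times> (real^'n) \<times> (real^'n^'n). ?r1 (fst (snd q)))" for A
    proof (rule continuous_on_coordinatewise_then_product)
      show "continuous_on A (\<lambda>q. ?r1 (fst (snd q)) j)" for j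
        by (cases "j < m1") (auto intro: coord)
    qed
    have r2: "continuous_on A (\<lambda>q :: (real^'n) \<times> (nat \<Rightarrow> real) \<times> (real^'n) \<times> (real^'n^'n). ?r2 (fst (snd q)))" for A
    proof (rule continuous_on_coordinatewise_then_product)
      show "continuous_on A (\<lambda>q. ?r2 (fst (snd q)) j)" for j
        by (cases "j < m2") (auto intro: coord continuous_on_minus)
    qed
    show "continuous_on ?D (\<lambda>(x, r, p, X). flip_system m1 m2 F i x r p X)"
    proof (cases "i < m1")
      case True
      have "continuous_on ?D ((\<lambda>(x, r, s, p, X). F i x r s p X) \<circ>
          (\<lambda>q. (fst q, ?r1 (fst (snd q)), ?r2 (fst (snd q)), fst (snd (snd q)), snd (snd (snd q)))))"
        by (intro continuous_on_compose continuous_on_subset[OF F] continuous_on_Pair r1 r2 continuous_intros)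
          (auto simp: in_Rvec)
      then show ?thesis using True by (simp add: flip_system_def case_prod_beta comp_def)
    next
      case False
      have "continuous_on ?D ((\<lambda>(x, r, s, p, X). F i x r s p X) \<circ>
          (\<lambda>q. (fst q, ?r1 (fst (snd q)), ?r2 (fst (snd q)), - fst (snd (snd q)), - snd (snd (snd q)))))"
        by (intro continuous_on_compose continuous_on_subset[OF F] continuous_on_Pair r1 r2 continuous_intros)
          (auto simp: in_Rvec uminus_sym_matrices)
      then have "continuous_on ?D (\<lambda>q. - ((\<lambda>(x, r, s, p, X). F i x r s p X) \<circ>
          (\<lambda>q. (fst q, ?r1 (fst (snd q)), ?r2 (fst (snd q)), - fst (snd (snd q)), - snd (snd (snd q))))) q)"
        by (rule continuous_on_minus)
      then show ?thesis using False by (simp add: flip_system_def case_prod_beta comp_def)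
    qed
  }
  fix x assume x: "x \<in> \<Omega>"
  show "flip_system m1 m2 F i x r p Y \<le> flip_system m1 m2 F i x r p X"
    if "X \<in> sym_matrices" "Y \<in> sym_matrices" "matrix_le X Y" for r p X Y
    using ell i x that in_Rvec[of r] uminus_sym_matrices[OF that(1)] uminus_sym_matrices[OF that(2)]
      matrix_le_uminus[OF that(3)]
    unfolding degenerate_elliptic_def flip_system_def by auto
  show "flip_system m1 m2 F i x \<rho> p X \<le> flip_system m1 m2 F i x r p X"
    if X: "X \<in> sym_matrices" and le: "vec_le (m1 + m2) r \<rho>" and eq: "r i = \<rho> i" for r \<rho> p X
  proof -
    have le1: "vec_le m1 (?r1 r) (?r1 \<rho>)" and le2: "vec_le m2 (?r2 \<rho>) (?r2 r)"
      using le by (auto simp: vec_le_def)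
    from i show ?thesis
    proof (cases rule: less_add_cases)
      case 1
      \<comment> \<open>The blocks are changed one at a time: the opposite block freely, then the
        block containing the index, where that component is held fixed.\<close>
      have "F i x (?r1 \<rho>) (?r2 \<rho>) p X \<le> F i x (?r1 \<rho>) (?r2 r) p X"
        using bqm x X 1 in_Rvec le2 unfolding balanced_quasi_monotone_def by blast
      also have "\<dots> \<le> F i x (?r1 r) (?r2 r) p X"
      proof -
        have "?r1 r i = ?r1 \<rho> i" using eq 1 by simp
        then show ?thesis
          using bqm x X 1 in_Rvec le1 unfolding balanced_quasi_monotone_def by blast
      qed
      finally show ?thesis using 1 by (simp add: flip_system_def)
    next
      case (2 j)
      note X' = uminus_sym_matrices[OF X]
      have "F i x (?r1 r) (?r2 r) (- p) (- X) \<le> F i x (?r1 \<rho>) (?r2 r) (- p) (- X)"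
        unfolding 2(1) using bqm x X' 2(2) in_Rvec le1 unfolding balanced_quasi_monotone_def by blast
      also have "\<dots> \<le> F i x (?r1 \<rho>) (?r2 \<rho>) (- p) (- X)"
      proof -
        have "?r2 \<rho> j = ?r2 r j" using eq 2 by simp
        then show ?thesis
          unfolding 2(1) using bqm x X' 2(2) in_Rvec le2 unfolding balanced_quasi_monotone_def by blast
      qed
      finally show ?thesis using 2 by (simp add: flip_system_def)
    qed
  qed
qed

theorem theorem3p2:
  fixes \<Omega> :: "(real^'n) set"
    and m1 m2 :: nat
    and F :: "'n nonlinearity"
    and z1 z2 w1 w2 :: "real^'n \<Rightarrow> nat \<Rightarrow> real"
  assumes "open \<Omega>" and "bounded \<Omega>"
    and "1 \<le> m1"
    and "continuous_system \<Omega> m1 m2 F"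
    and "degenerate_elliptic \<Omega> m1 m2 F"
    and "balanced_quasi_monotone \<Omega> m1 m2 F"
    and "super_sub_solution \<Omega> m1 m2 F z1 z2"
    and "sub_super_solution \<Omega> m1 m2 F w1 w2"
    and "\<forall>x\<in>\<Omega>. vec_le m1 (w1 x) (z1 x)"
    and "\<forall>x\<in>\<Omega>. vec_le m2 (z2 x) (w2 x)"
  shows "\<exists>u1 u2. system_solution \<Omega> m1 m2 F u1 u2 \<and>
           (\<forall>x\<in>\<Omega>. vec_le m1 (w1 x) (u1 x) \<and> vec_le m1 (u1 x) (z1 x)) \<and>
           (\<forall>x\<in>\<Omega>. vec_le m2 (z2 x) (u2 x) \<and> vec_le m2 (u2 x) (w2 x))"
proof -
  let ?G = "flip_system m1 m2 F" and ?m = "m1 + m2"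
  let ?z = "flip_join m1 z1 z2" and ?w = "flip_join m1 w1 w2"
  interpret quasi_monotone_system \<Omega> ?m ?G
    using assms by (intro quasi_monotone_flip_system)
  have z: "supersolution \<Omega> ?m ?G ?z" and zb: "bounded_vector_fun \<Omega> m1 z1" "bounded_vector_fun \<Omega> m2 z2"
    using assms(7) by (simp_all add: flip_join_super)
  have w: "subsolution \<Omega> ?m ?G ?w" and wb: "bounded_vector_fun \<Omega> m1 w1" "bounded_vector_fun \<Omega> m2 w2"
    using assms(8) by (simp_all add: flip_join_sub)
  have "?w x i \<le> ?z x i" if "x \<in> \<Omega>" "i < ?m" for x i
    using assms(9,10) that by (auto simp: flip_join_def vec_le_def)
  from perron[OF w z bounded_flip_join[OF wb] bounded_flip_join[OF zb] this]
  obtain u where u: "subsolution \<Omega> ?m ?G u" "supersolution \<Omega> ?m ?G u"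
    and between: "\<And>x i. x \<in> \<Omega> \<Longrightarrow> i < ?m \<Longrightarrow> ?w x i \<le> u x i \<and> u x i \<le> ?z x i" by blast
  \<comment> \<open>The sign change is undone and each group is cut to an extensional vector, as
    membership in \<open>Rvec\<close> demands.\<close>
  define u1 where "u1 x = restrict (u x) {..<m1}" for x
  define u2 where "u2 x = (\<lambda>j\<in>{..<m2}. - u x (m1 + j))" for x
  have le1: "w1 x j \<le> u1 x j \<and> u1 x j \<le> z1 x j" if "x \<in> \<Omega>" "j < m1" for x j
    using between[of x j] that by (simp add: u1_def flip_join_apply)
  have le2: "z2 x j \<le> u2 x j \<and> u2 x j \<le> w2 x j" if "x \<in> \<Omega>" "j < m2" for x j
    using between[of x "m1 + j"] that by (simp add: u2_def flip_join_apply)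
  have ub: "bounded_vector_fun \<Omega> m1 u1" "bounded_vector_fun \<Omega> m2 u2"
  proof -
    have "bounded ((\<lambda>x. u1 x j) ` \<Omega>)" if "j < m1" for j
      by (rule bounded_image_between[of "\<lambda>x. w1 x j" \<Omega> "\<lambda>x. z1 x j"])
        (use zb(1) wb(1) le1 that in \<open>auto simp: bounded_vector_fun_def\<close>)
    then show "bounded_vector_fun \<Omega> m1 u1" by (simp add: bounded_vector_fun_def Rvec_def u1_def)
    have "bounded ((\<lambda>x. u2 x j) ` \<Omega>)" if "j < m2" for j
      by (rule bounded_image_between[of "\<lambda>x. z2 x j" \<Omega> "\<lambda>x. w2 x j"])
        (use zb(2) wb(2) le2 that in \<open>auto simp: bounded_vector_fun_def\<close>)
    then show "bounded_vector_fun \<Omega> m2 u2" by (simp add: bounded_vector_fun_def Rvec_def u2_def)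
  qed
  have eq: "flip_join m1 u1 u2 x i = u x i" if "i < ?m" for x i
    using that by (auto simp: flip_join_def u1_def u2_def)
  \<comment> \<open>Joining the pieces recovers \<open>u\<close> only in the components below
    \<open>m1 + m2\<close>, and these determine the envelope vectors and the tests.\<close>
  have "usc_env_vec ?m \<Omega> (flip_join m1 u1 u2) = usc_env_vec ?m \<Omega> u"
    "lsc_env_vec ?m \<Omega> (flip_join m1 u1 u2) = lsc_env_vec ?m \<Omega> u"
    by (auto simp: usc_env_vec_def lsc_env_vec_def eq fun_eq_iff)
  then have "subsolution \<Omega> ?m ?G (flip_join m1 u1 u2)" "supersolution \<Omega> ?m ?G (flip_join m1 u1 u2)"
    using u by (auto simp: subsolution_def supersolution_def eq)
  then have "system_solution \<Omega> m1 m2 F u1 u2"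
    using ub by (simp add: system_solution_def flip_join_super flip_join_sub)
  with le1 le2 show ?thesis unfolding vec_le_def by blast
qed

end
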